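(* Let $0<\epsilon<1$ and $r>0$ be constants, and let $p_2=\frac{1-\epsilon}{n}$, $p_3=\frac{r}{n\ln n}$. Define $$I_{\epsilon,r}=\int_{0}^{\epsilon/r}\big[1-\lambda(\omega)+\ln \lambda(\omega)\big]\,d\omega=-\frac{1}{r}\Big[\epsilon-\frac{\epsilon^2}{2}+(1-\epsilon)\ln(1-\epsilon)\Big],\qquad \lambda(x)=1-\epsilon+rx.$$ Then, as $n\to\infty$: (i) if $I_{\epsilon,r}<-1$, then with high probability $\mathbb{G}(n,p_2,p_3)$ is not propagation connected; (ii) if $I_{\epsilon,r}>-1$, then with high probability $\mathbb{G}(n,p_2,p_3)$ is propagation connected.
   Context: $\mathbb{G}(n,p_2,p_3)$ is the random hypergraph on a vertex set $V$ with $|V|=n$ in which each of the $\binom n2$ possible 2-element edges is present with probability $p_2$ and each of the $\binom n3$ possible 3-element hyperedges is present with probability $p_3$, all independently. "With high probability" (w.h.p.) means with probability tending to $1$ as $n\to\infty$. A hypergraph $H=(V,E)$ on $n$ vertices whose edges have size 2 or 3 is propagation connected if there exist edges $e_1,e_2,\dots,e_{n-1}\in E$ such that for every $1\le l\le n-2$, $|e_{l+1}\cap\bigcup_{i=1}^{l}e_i|=|e_{l+1}|-1$ (i.e. each new edge contains exactly one vertex not covered by the previous edges). *)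

theory Defs
  imports "HOL-Probability.Probability"
begin

definition edges2 :: "nat \<Rightarrow> nat set set" where
  "edges2 n = {e. e \<subseteq> {..<n} \<and> card e = 2}"

definition edges3 :: "nat \<Rightarrow> nat set set" where
  "edges3 n = {e. e \<subseteq> {..<n} \<and> card e = 3}"

text \<open>The random hypergraph G(n,p2,p3): each possible 2-edge is present independently
  with probability p2, each possible 3-edge with probability p3. An outcome is the
  indicator function of the edge set (False outside the possible edges).\<close>

definition random_hypergraph :: "nat \<Rightarrow> real \<Rightarrow> real \<Rightarrow> (nat set \<Rightarrow> bool) pmf" where
  "random_hypergraph n p2 p3 =
     Pi_pmf (edges2 n \<union> edges3 n) False
       (\<lambda>e. bernoulli_pmf (if card e = 2 then p2 else p3))"

definition propagation_connected :: "'a set \<Rightarrow> 'a set set \<Rightarrow> bool" where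
  "propagation_connected V E \<longleftrightarrow>
     (\<exists>e :: nat \<Rightarrow> 'a set.
        (\<forall>i \<in> {1..card V - 1}. e i \<in> E) \<and>
        (\<forall>l \<in> {1..card V - 2}.
           card (e (l + 1) \<inter> (\<Union>i \<in> {1..l}. e i)) = card (e (l + 1)) - 1))"

text \<open>The constant I_{eps,r} (closed form of the integral).\<close>

definition I_const :: "real \<Rightarrow> real \<Rightarrow> real" where
  "I_const \<epsilon> r = - (1 / r) * (\<epsilon> - \<epsilon>\<^sup>2 / 2 + (1 - \<epsilon>) * ln (1 - \<epsilon>))"

end

theory Submission
  imports Defs "HOL-Real_Asymp.Real_Asymp"
begin

text \<open>Explore the hypergraph vertex by vertex. After \<open>t = \<omega> ln n\<close> processed vertices the next one has
  about Poisson(\<open>\<lambda>\<close>) many children, where \<open>\<lambda> = 1 - \<epsilon> + r \<omega>\<close>, so that staying alive costs a factor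
  \<open>\<lambda> exp (1 - \<lambda>)\<close> per step until the process becomes critical at \<open>\<omega> = \<epsilon> / r\<close>. A start vertex thus
  survives the subcritical phase with probability \<open>n powr (I + o(1))\<close>. If \<open>I < -1\<close>, a union bound over
  the start vertices shows that no exploration survives; the matching upper bound on the survival
  probability comes from an exponential tilt with time-dependent weights.

  If \<open>I > -1\<close>, about \<open>n / (ln n) ^ 5\<close> successive attempts are made, each on fresh vertices and
  therefore independent of the previous ones. Processing \<open>b\<close> vertices at once and asking for \<open>b\<close> children
  in each block loses only a factor of order \<open>1 / b\<close> per block against the optimal cost, hence a small
  power of \<open>n\<close> in total when \<open>b\<close> is a large constant. Once \<open>\<lambda>\<close> exceeds a constant, the block size
  is doubled until \<open>(ln n) ^ 3\<close> vertices are reached. Such a set is contained in a propagating set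
  closed under triples, and a first moment bound excludes all closed sets of this size other than the
  whole vertex set.\<close>

section \<open>Exploring independent edges\<close>

text \<open>Dependence on the coordinates in \<open>J\<close> only. It takes the place of a
  sigma-algebra: independence becomes disjointness of index sets.\<close>

definition determined_by :: "'a set \<Rightarrow> (('a \<Rightarrow> 'b) \<Rightarrow> 'c) \<Rightarrow> bool" where
  "determined_by J Q \<longleftrightarrow> (\<forall>G G'. (\<forall>e\<in>J. G e = G' e) \<longrightarrow> Q G = Q G')"

lemma determined_byI:
  "(\<And>G G'. (\<And>e. e \<in> J \<Longrightarrow> G e = G' e) \<Longrightarrow> Q G = Q G') \<Longrightarrow> determined_by J Q"
  unfolding determined_by_def by blast

lemma determined_byD:
  "determined_by J Q \<Longrightarrow> (\<And>e. e \<in> J \<Longrightarrow> G e = G' e) \<Longrightarrow> Q G = Q G'"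
  unfolding determined_by_def by blast

lemma prob_pair_pmf_Times:
  "measure_pmf.prob (pair_pmf p q) (A \<times> B) = measure_pmf.prob p A * measure_pmf.prob q B"
proof -
  \<comment> \<open>Intersecting with the supports makes both factors countable, as the product rule
    for pmfs requires.\<close>
  have "measure_pmf.prob (pair_pmf p q) (A \<times> B)
      = measure_pmf.prob (pair_pmf p q) ((A \<times> B) \<inter> set_pmf (pair_pmf p q))"
    by (rule measure_Int_set_pmf[symmetric])
  also have "(A \<times> B) \<inter> set_pmf (pair_pmf p q) = (A \<inter> set_pmf p) \<times> (B \<inter> set_pmf q)"
    by auto
  also have "measure_pmf.prob (pair_pmf p q) \<dots>
      = measure_pmf.prob p (A \<inter> set_pmf p) * measure_pmf.prob q (B \<inter> set_pmf q)"
    by (intro measure_pmf_prob_product countable_Int2 countable_set_pmf)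
  finally show ?thesis
    by (simp add: measure_Int_set_pmf)
qed

text \<open>Split the coordinates into \<open>I \<inter> J\<close> and \<open>I - J\<close>. The two
  parts are independent; \<open>Q\<close> reads only the first and \<open>R\<close> only the
  second.\<close>

lemma prob_Pi_pmf_indep:
  assumes "finite I" and Q: "determined_by J Q" and R: "determined_by K R" and JK: "J \<inter> K = {}"
  shows "measure_pmf.prob (Pi_pmf I d p) {G. Q G \<and> R G} =
    measure_pmf.prob (Pi_pmf I d p) {G. Q G} * measure_pmf.prob (Pi_pmf I d p) {G. R G}"
proof -
  let ?h = "\<lambda>(f, g) x. if x \<in> I \<inter> J then f x else g x"
  let ?p = "Pi_pmf (I \<inter> J) d p" and ?q = "Pi_pmf (I - J) d p"
  have M: "Pi_pmf I d p = map_pmf ?h (pair_pmf ?p ?q)"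
    using Pi_pmf_union[of "I \<inter> J" "I - J" d p] \<open>finite I\<close>
    by (simp add: Int_Diff_Un Int_Diff_disjoint)
  \<comment> \<open>\<open>J\<close> may reach outside \<open>I\<close>; there both components take
    the default value \<open>d\<close> on their supports.\<close>
  have Qh: "Q (?h (f, g)) = Q f" if "f \<in> set_pmf ?p" "g \<in> set_pmf ?q" for f g
  proof (rule determined_byD[OF Q])
    fix e assume "e \<in> J"
    with that show "?h (f, g) e = f e"
      using set_Pi_pmf_subset[of "I \<inter> J" d p] set_Pi_pmf_subset[of "I - J" d p] \<open>finite I\<close>
      by (auto dest!: subsetD)
  qed
  have Rh: "R (?h (f, g)) = R g" for f g
    using JK by (intro determined_byD[OF R]) auto
  have split: "measure_pmf.prob (Pi_pmf I d p) {G. S G \<and> T G} =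
      measure_pmf.prob ?p {f. S' f} * measure_pmf.prob ?q {g. T' g}"
    if "\<And>f g. f \<in> set_pmf ?p \<Longrightarrow> g \<in> set_pmf ?q \<Longrightarrow> S (?h (f, g)) = S' f"
       "\<And>f g. T (?h (f, g)) = T' g" for S T S' T'
  proof -
    have "measure_pmf.prob (Pi_pmf I d p) {G. S G \<and> T G} =
        measure_pmf.prob (pair_pmf ?p ?q) (?h -` {G. S G \<and> T G} \<inter> set_pmf (pair_pmf ?p ?q))"
      unfolding M measure_map_pmf by (rule measure_Int_set_pmf[symmetric])
    also have "?h -` {G. S G \<and> T G} \<inter> set_pmf (pair_pmf ?p ?q) =
        ({f. S' f} \<times> {g. T' g}) \<inter> set_pmf (pair_pmf ?p ?q)"
    proof (intro set_eqI)
      fix fg show "fg \<in> ?h -` {G. S G \<and> T G} \<inter> set_pmf (pair_pmf ?p ?q) \<longleftrightarrow>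
          fg \<in> ({f. S' f} \<times> {g. T' g}) \<inter> set_pmf (pair_pmf ?p ?q)"
        using that[of "fst fg" "snd fg"] by (cases fg) auto
    qed
    finally show ?thesis
      by (simp only: measure_Int_set_pmf prob_pair_pmf_Times)
  qed
  have 1: "measure_pmf.prob ?p UNIV = 1" "measure_pmf.prob ?q UNIV = 1"
    by (simp_all add: measure_pmf.prob_space[simplified])
  \<comment> \<open>The three instances are the conjunction and each event paired with a trivial
    one.\<close>
  show ?thesis
    using split[of Q Q R R] split[of Q Q "\<lambda>_. True" "\<lambda>_. True"]
      split[of "\<lambda>_. True" "\<lambda>_. True" R R] Qh Rh by simp
qed

lemma prob_Pi_pmf_Ball:
  fixes p :: "'a \<Rightarrow> 'b pmf"
  assumes "finite I" "finite W" and Q: "\<And>w. w \<in> W \<Longrightarrow> determined_by (J w) (Q w)"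
    and disj: "disjoint_family_on J W"
  shows "measure_pmf.prob (Pi_pmf I d p) {G. \<forall>w\<in>W. Q w G} =
    (\<Prod>w\<in>W. measure_pmf.prob (Pi_pmf I d p) {G. Q w G})"
  using \<open>finite W\<close> Q disj
proof (induction W rule: finite_induct)
  case empty
  then show ?case by (simp add: measure_pmf.prob_space[simplified])
next
  case (insert w W)
  have "determined_by (\<Union>v\<in>W. J v) (\<lambda>G. \<forall>v\<in>W. Q v G)"
  proof (rule determined_byI)
    fix G G' :: "'a \<Rightarrow> 'b" assume "\<And>e. e \<in> (\<Union>v\<in>W. J v) \<Longrightarrow> G e = G' e"
    then have "Q v G = Q v G'" if "v \<in> W" for v
      using determined_byD[OF insert.prems(1)[of v]] that by blast
    then show "(\<forall>v\<in>W. Q v G) = (\<forall>v\<in>W. Q v G')" by blast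
  qed
  moreover have "J w \<inter> (\<Union>v\<in>W. J v) = {}"
    using insert.prems(2) insert.hyps(2) by (fastforce simp: disjoint_family_on_def)
  ultimately have "measure_pmf.prob (Pi_pmf I d p) {G. Q w G \<and> (\<forall>v\<in>W. Q v G)} =
      measure_pmf.prob (Pi_pmf I d p) {G. Q w G} *
      measure_pmf.prob (Pi_pmf I d p) {G. \<forall>v\<in>W. Q v G}"
    using insert.prems(1) by (intro prob_Pi_pmf_indep[OF \<open>finite I\<close>]) auto
  moreover have "disjoint_family_on J W"
    using insert.prems(2) by (auto simp: disjoint_family_on_def)
  ultimately show ?case
    using insert by simp
qed

text \<open>Deferred decisions: given \<open>sel G = x\<close>, which depends on \<open>J\<close>
  only, the event \<open>F x\<close> keeps its unconditional probability because it reads the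
  disjoint set \<open>K\<close>.\<close>

lemma prob_Pi_pmf_step_le:
  assumes "finite I" "finite X" and sel: "determined_by J sel" and range: "\<And>G. sel G \<in> X"
    and F: "\<And>x. x \<in> X \<Longrightarrow> determined_by K (F x)" and JK: "J \<inter> K = {}"
    and le: "\<And>x. x \<in> X \<Longrightarrow> measure_pmf.prob (Pi_pmf I d p) {G. F x G} \<le> h x"
  shows "measure_pmf.prob (Pi_pmf I d p) {G. F (sel G) G} \<le>
    (\<Sum>x\<in>X. measure_pmf.prob (Pi_pmf I d p) {G. sel G = x} * h x)"
proof -
  let ?P = "measure_pmf.prob (Pi_pmf I d p)"
  have "{G. F (sel G) G} = (\<Union>x\<in>X. {G. sel G = x \<and> F x G})"
    using range by auto
  then have "?P {G. F (sel G) G} = (\<Sum>x\<in>X. ?P {G. sel G = x \<and> F x G})"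
    by (simp only:) (rule measure_pmf.finite_measure_finite_Union,
      use \<open>finite X\<close> in \<open>auto simp: disjoint_family_on_def\<close>)
  also have "\<dots> \<le> (\<Sum>x\<in>X. ?P {G. sel G = x} * h x)"
  proof (rule sum_mono)
    fix x assume x: "x \<in> X"
    have "determined_by J (\<lambda>G. sel G = x)"
      using sel by (auto simp: determined_by_def)
    then have "?P {G. sel G = x \<and> F x G} = ?P {G. sel G = x} * ?P {G. F x G}"
      by (rule prob_Pi_pmf_indep[OF \<open>finite I\<close> _ F[OF x] JK])
    also have "\<dots> \<le> ?P {G. sel G = x} * h x"
      by (intro mult_left_mono le x) auto
    finally show "?P {G. sel G = x \<and> F x G} \<le> ?P {G. sel G = x} * h x" .
  qed
  finally show ?thesis .
qed

text \<open>The edges through which \<open>w\<close> can be discovered while the block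
  \<open>B\<close> is processed and \<open>P\<close> has been processed before. Triples with two
  vertices in \<open>B\<close> are ignored, which gives a simple exact count; for a singleton block
  nothing is lost.\<close>

definition links :: "'a set \<Rightarrow> 'a set \<Rightarrow> 'a \<Rightarrow> 'a set set" where
  "links P B w = (\<lambda>u. {u, w}) ` B \<union> (\<lambda>(u, p). {u, p, w}) ` (B \<times> P)"

definition children :: "('a set \<Rightarrow> bool) \<Rightarrow> 'a set \<Rightarrow> 'a set \<Rightarrow> 'a set \<Rightarrow> 'a set" where
  "children G P B U = {w \<in> U. \<exists>e\<in>links P B w. G e}"

lemma children_subset: "children G P B U \<subseteq> U"
  by (auto simp: children_def)

text \<open>All other vertices of a link are processed or in the current block. A link is thus tied
  to one vertex outside, which separates it from the links of other vertices and from edges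
  inspected later.\<close>

lemma links_cut:
  assumes "e \<in> links P B w" "w \<in> R" "(P \<union> B) \<inter> R = {}"
  shows "e \<inter> R = {w}"
  using assms by (auto simp: links_def)

lemma disjoint_family_links:
  assumes "(P \<union> B) \<inter> U = {}"
  shows "disjoint_family_on (links P B) U"
  unfolding disjoint_family_on_def
  using links_cut[of _ P B _ U] assms by (metis disjoint_iff singleton_inject)

lemma determined_by_children:
  "determined_by (\<Union>w\<in>U. links P B w) (\<lambda>G. children G P B U)"
  by (auto intro!: determined_byI simp: children_def)

lemma sum_Pow_insert:
  assumes "finite U" "x \<notin> U"
  shows "(\<Sum>X\<in>Pow (insert x U). f X) = (\<Sum>X\<in>Pow U. f X) + (\<Sum>X\<in>Pow U. f (insert x X))"
proof -
  have "inj_on (insert x) (Pow U)"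
    using assms(2) by (intro inj_onI) (metis PowD insert_ident subsetD)
  moreover have "Pow U \<inter> insert x ` Pow U = {}"
    using assms(2) by auto
  ultimately show ?thesis
    using assms(1) by (simp add: Pow_insert sum.union_disjoint sum.reindex)
qed

text \<open>The generating function of the binomial distribution, by expanding a product over
  \<open>U\<close>.\<close>

lemma sum_Pow_binomial:
  fixes q y :: real
  assumes "finite U"
  shows "(\<Sum>C\<in>Pow U. q ^ card C * (1 - q) ^ (card U - card C) * y ^ card C) = (1 + q * (y - 1)) ^ card U"
proof -
  have "(1 + q * (y - 1)) ^ card U = (\<Prod>w\<in>U. q * y + (1 - q))"
    by (simp add: algebra_simps)
  also have "\<dots> = (\<Sum>C\<in>Pow U. (\<Prod>w\<in>C. q * y) * (\<Prod>w\<in>U - C. 1 - q))"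
    by (rule prod_add[OF assms])
  also have "\<dots> = (\<Sum>C\<in>Pow U. q ^ card C * (1 - q) ^ (card U - card C) * y ^ card C)"
    using assms by (intro sum.cong) (auto simp: card_Diff_subset finite_subset power_mult_distrib)
  finally show ?thesis by simp
qed

section \<open>One exploration step in the random hypergraph\<close>

locale hypergraph_model =
  fixes n :: nat and p2 p3 :: real
  assumes p2: "0 \<le> p2" "p2 \<le> 1" and p3: "0 \<le> p3" "p3 \<le> 1"
begin

abbreviation "pr \<equiv> measure_pmf.prob (random_hypergraph n p2 p3)"

text \<open>The probability that an unseen vertex is a child of a block of size \<open>m\<close>
  when \<open>t\<close> vertices have been processed: there are \<open>m\<close> pairs and
  \<open>m * t\<close> triples as possible links.\<close>

definition hit :: "nat \<Rightarrow> nat \<Rightarrow> real" where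
  "hit t m = 1 - (1 - p2) ^ m * (1 - p3) ^ (m * t)"

lemma hit_bounds: "0 \<le> hit t m" "hit t m \<le> 1"
  using p2 p3 by (auto simp: hit_def mult_le_one power_le_one)

lemma finite_edges: "finite (edges2 n \<union> edges3 n)"
  by (auto simp: edges2_def edges3_def intro: finite_subset[of _ "Pow {..<n}"])

lemma prob_absent:
  assumes "e \<in> edges2 n \<union> edges3 n"
  shows "pr {G. \<not> G e} = 1 - (if card e = 2 then p2 else p3)"
proof -
  have "pr {G. \<not> G e} = measure_pmf.prob (map_pmf (\<lambda>G. G e) (random_hypergraph n p2 p3)) {False}"
    by (simp add: vimage_def)
  also have "\<dots> = pmf (bernoulli_pmf (if card e = 2 then p2 else p3)) False"
    using assms finite_edges by (simp add: random_hypergraph_def Pi_pmf_component measure_pmf_single)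
  finally show ?thesis
    using p2 p3 by simp
qed

lemma prob_all_absent:
  assumes "L \<subseteq> edges2 n \<union> edges3 n"
  shows "pr {G. \<forall>e\<in>L. \<not> G e} = (\<Prod>e\<in>L. 1 - (if card e = 2 then p2 else p3))"
proof -
  have "pr {G. \<forall>e\<in>L. \<not> G e} = (\<Prod>e\<in>L. pr {G. \<not> G e})"
    unfolding random_hypergraph_def
    by (rule prob_Pi_pmf_Ball[where J = "\<lambda>e. {e}"])
       (use finite_edges assms finite_subset in
         \<open>auto simp: determined_by_def disjoint_family_on_def\<close>)
  also have "\<dots> = (\<Prod>e\<in>L. 1 - (if card e = 2 then p2 else p3))"
    using assms by (intro prod.cong) (auto simp: prob_absent)
  finally show ?thesis .
qed

lemma links_subset_edges:
  assumes "P \<subseteq> {..<n}" "B \<subseteq> {..<n}" "w < n" "P \<inter> B = {}" "w \<notin> P" "w \<notin> B"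
  shows "links P B w \<subseteq> edges2 n \<union> edges3 n"
proof -
  have "u \<noteq> w" "p \<noteq> w" "u \<noteq> p" if "u \<in> B" "p \<in> P" for u p
    using that assms by auto
  moreover have "u \<noteq> w" if "u \<in> B" for u
    using that assms by auto
  ultimately show ?thesis
    using assms by (auto simp: links_def edges2_def edges3_def)
qed

lemma prob_no_link:
  assumes "P \<subseteq> {..<n}" "B \<subseteq> {..<n}" "w < n" "P \<inter> B = {}" "w \<notin> P" "w \<notin> B"
  shows "pr {G. \<forall>e\<in>links P B w. \<not> G e} = 1 - hit (card P) (card B)"
proof -
  let ?c = "\<lambda>e::nat set. 1 - (if card e = 2 then p2 else p3)"
  have fin: "finite P" "finite B"
    using assms finite_subset[OF _ finite_lessThan] by blast+
  have inj2: "inj_on (\<lambda>u. {u, w}) B"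
    using assms by (intro inj_onI) (auto simp: doubleton_eq_iff)
  have inj3: "inj_on (\<lambda>(u, p). {u, p, w}) (B \<times> P)"
  proof (rule inj_onI, clarify)
    fix u p u' p' assume *: "u \<in> B" "p \<in> P" "u' \<in> B" "p' \<in> P" "{u, p, w} = {u', p', w}"
    \<comment> \<open>The traces on the disjoint sets \<open>B\<close> and \<open>P\<close> recover
      the two other vertices from the triple.\<close>
    have "{x, y, w} \<inter> B = {x} \<and> {x, y, w} \<inter> P = {y}" if "x \<in> B" "y \<in> P" for x y
      using that assms by auto
    from this[OF *(1,2)] this[OF *(3,4)] *(5) show "u = u' \<and> p = p'"
      by (metis singleton_inject)
  qed
  have c2: "card {u, w} = 2" if "u \<in> B" for u
    using that assms by (auto simp: card_insert_if)
  have c3: "card {u, p, w} = 3" if "u \<in> B" "p \<in> P" for u p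
    using that assms by (auto simp: card_insert_if)
  have "pr {G. \<forall>e\<in>links P B w. \<not> G e} = (\<Prod>e\<in>links P B w. ?c e)"
    by (intro prob_all_absent links_subset_edges assms)
  also have "\<dots> = (\<Prod>e\<in>(\<lambda>u. {u, w}) ` B. ?c e) * (\<Prod>e\<in>(\<lambda>(u, p). {u, p, w}) ` (B \<times> P). ?c e)"
    unfolding links_def
  proof (rule prod.union_disjoint)
    show "(\<lambda>u. {u, w}) ` B \<inter> (\<lambda>(u, p). {u, p, w}) ` (B \<times> P) = {}"
    proof (rule equals0I, elim IntE)
      fix e assume "e \<in> (\<lambda>u. {u, w}) ` B" "e \<in> (\<lambda>(u, p). {u, p, w}) ` (B \<times> P)"
      then have "card e = 2" "card e = 3" using c2 c3 by auto
      then show False by simp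
    qed
  qed (use fin in auto)
  also have "(\<Prod>e\<in>(\<lambda>u. {u, w}) ` B. ?c e) = (\<Prod>u\<in>B. 1 - p2)"
    by (subst prod.reindex[OF inj2], rule prod.cong) (auto simp: c2)
  also have "(\<Prod>e\<in>(\<lambda>(u, p). {u, p, w}) ` (B \<times> P). ?c e) = (\<Prod>(u, p)\<in>B \<times> P. 1 - p3)"
    by (subst prod.reindex[OF inj3], rule prod.cong) (auto simp: c3)
  finally show ?thesis
    by (simp add: hit_def card_cartesian_product)
qed

text \<open>Distinct unseen vertices have disjoint sets of links, so they become children
  independently, each with probability \<open>hit\<close>.\<close>

lemma prob_children:
  assumes V: "P \<union> B \<union> U \<subseteq> {..<n}" and disj: "P \<inter> B = {}" "(P \<union> B) \<inter> U = {}" and X: "X \<subseteq> U"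
  shows "pr {G. children G P B U = X} =
    hit (card P) (card B) ^ card X * (1 - hit (card P) (card B)) ^ (card U - card X)"
proof -
  let ?q = "hit (card P) (card B)"
  let ?Q = "\<lambda>w G. (\<exists>e\<in>links P B w. G e) = (w \<in> X)"
  have fin: "finite U" using V finite_subset[OF _ finite_lessThan] by blast
  have no: "pr {G. \<forall>e\<in>links P B w. \<not> G e} = 1 - ?q" if "w \<in> U" for w
    using that V disj by (intro prob_no_link) auto
  have one: "pr {G. \<exists>e\<in>links P B w. G e} = ?q" if "w \<in> U" for w
  proof -
    have "{G. \<exists>e\<in>links P B w. G e} = UNIV - {G. \<forall>e\<in>links P B w. \<not> G e}" by auto
    then show ?thesis
      using measure_pmf.prob_compl[of "{G. \<forall>e\<in>links P B w. \<not> G e}" "random_hypergraph n p2 p3"]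
        no[OF that] by simp
  qed
  have "pr {G. children G P B U = X} = pr {G. \<forall>w\<in>U. ?Q w G}"
    using X by (intro arg_cong[where f = pr]) (auto simp: children_def)
  also have "\<dots> = (\<Prod>w\<in>U. pr {G. ?Q w G})"
    unfolding random_hypergraph_def
    by (rule prob_Pi_pmf_Ball[where J = "links P B"])
       (use finite_edges fin disj in \<open>auto simp: determined_by_def intro: disjoint_family_links\<close>)
  also have "\<dots> = (\<Prod>w\<in>U. if w \<in> X then ?q else 1 - ?q)"
    using one no by (intro prod.cong) auto
  also have "\<dots> = ?q ^ card X * (1 - ?q) ^ card (U - X)"
    using X fin by (simp add: prod.If_cases Int_absorb1 Diff_eq[symmetric])
  also have "card (U - X) = card U - card X"
    using X fin by (simp add: card_Diff_subset finite_subset)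
  finally show ?thesis .
qed

text \<open>The edges inspected in one step meet the unprocessed vertices \<open>(A - B) \<union> U\<close> in a
  single vertex, whereas all later steps only inspect edges meeting them twice.\<close>

lemma prob_children_step_le:
  assumes V: "P \<union> A \<union> U \<subseteq> {..<n}" and disj: "P \<inter> A = {}" "(P \<union> A) \<inter> U = {}" and B: "B \<subseteq> A"
    and F: "\<And>C. C \<subseteq> U \<Longrightarrow> determined_by {e. 2 \<le> card (e \<inter> (A - B \<union> U))} (F C)"
    and le: "\<And>C. C \<subseteq> U \<Longrightarrow> pr {G. F C G} \<le> h C"
  shows "pr {G. F (children G P B U) G} \<le>
    (\<Sum>C\<in>Pow U. hit (card P) (card B) ^ card C *
      (1 - hit (card P) (card B)) ^ (card U - card C) * h C)"
proof -
  have fin: "finite U" using V finite_subset[OF _ finite_lessThan] by blast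
  have "pr {G. F (children G P B U) G} \<le> (\<Sum>C\<in>Pow U. pr {G. children G P B U = C} * h C)"
    unfolding random_hypergraph_def
  proof (rule prob_Pi_pmf_step_le[OF _ _ determined_by_children])
    show "(\<Union>w\<in>U. links P B w) \<inter> {e. 2 \<le> card (e \<inter> (A - B \<union> U))} = {}"
    proof -
      have "e \<inter> (A - B \<union> U) = {w}" if "w \<in> U" "e \<in> links P B w" for e w
        using that disj B by (intro links_cut) auto
      then show ?thesis by fastforce
    qed
  qed (use finite_edges fin F le[unfolded random_hypergraph_def] in \<open>auto simp: children_def\<close>)
  also have "\<dots> = (\<Sum>C\<in>Pow U. hit (card P) (card B) ^ card C *
      (1 - hit (card P) (card B)) ^ (card U - card C) * h C)"
    using V disj B by (intro sum.cong refl arg_cong2[where f = "(*)"] prob_children) auto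
  finally show ?thesis .
qed

text \<open>Almost surely only possible edges are present, so events need comparing on such outcomes
  only.\<close>

lemma prob_support:
  assumes "\<And>G. (\<And>e. G e \<Longrightarrow> e \<in> edges2 n \<union> edges3 n) \<Longrightarrow> Q G \<Longrightarrow> R G"
  shows "pr {G. Q G} \<le> pr {G. R G}"
proof -
  have "pr {G. Q G} = pr ({G. Q G} \<inter> set_pmf (random_hypergraph n p2 p3))"
    by (simp add: measure_Int_set_pmf)
  also have "\<dots> \<le> pr {G. R G}"
  proof (rule measure_pmf.finite_measure_mono)
    have "e \<in> edges2 n \<union> edges3 n" if "G \<in> set_pmf (random_hypergraph n p2 p3)" "G e" for G e
      using that subsetD[OF set_Pi_pmf_subset[OF finite_edges], of G False]
      unfolding random_hypergraph_def by auto
    then show "{G. Q G} \<inter> set_pmf (random_hypergraph n p2 p3) \<subseteq> {G. R G}"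
      by (intro subsetI CollectI, elim IntE CollectE) (rule assms)
  qed simp
  finally show ?thesis .
qed

end

section \<open>The exponent\<close>

text \<open>The logarithm of the cost factor \<open>x * exp (1 - x)\<close> of one step with mean
  offspring \<open>x\<close>.\<close>

definition rate :: "real \<Rightarrow> real" where
  "rate x = ln x + 1 - x"

text \<open>An antiderivative of \<open>rate\<close> on the positive reals.\<close>

definition Rate :: "real \<Rightarrow> real" where
  "Rate x = x * ln x - x\<^sup>2 / 2"

lemma rate_nonpos: "0 < x \<Longrightarrow> rate x \<le> 0"
  using ln_le_minus_one[of x] by (simp add: rate_def)

lemma rate_mono:
  assumes "0 < x" "x \<le> y" "y \<le> 1"
  shows "rate x \<le> rate y"
proof -
  have "ln (x / y) \<le> x / y - 1"
    using assms by (intro ln_le_minus_one) auto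
  also have "\<dots> = (x - y) / y"
    using assms by (simp add: field_simps)
  also have "\<dots> \<le> x - y"
    using assms by (simp add: divide_le_eq mult_left_le_one_le mult_le_cancel_left1)
  finally show ?thesis
    using assms by (simp add: rate_def ln_div)
qed

lemma DERIV_Rate: "0 < x \<Longrightarrow> (Rate has_real_derivative rate x) (at x)"
  unfolding Rate_def[abs_def] rate_def
  by (auto intro!: derivative_eq_intros)

text \<open>By the mean value theorem the difference is \<open>(y - x) * rate z\<close> for an
  intermediate \<open>z\<close>, and \<open>rate\<close> is nondecreasing up to 1.\<close>

lemma Rate_diff_bounds:
  assumes "0 < x" "x \<le> y" "y \<le> 1"
  shows "rate x * (y - x) \<le> Rate y - Rate x" "Rate y - Rate x \<le> rate y * (y - x)"
proof -
  have "rate x * (y - x) \<le> Rate y - Rate x \<and> Rate y - Rate x \<le> rate y * (y - x)"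
  proof (cases "x = y")
    case False
    then have "x < y" using assms by simp
    then obtain z where z: "x < z" "z < y" "Rate y - Rate x = (y - x) * rate z"
      using MVT2[of x y Rate rate] DERIV_Rate assms by force
    have "rate x \<le> rate z" "rate z \<le> rate y"
      using z assms by (intro rate_mono; simp)+
    then show ?thesis
      using z(3) \<open>x < y\<close> by (simp add: mult.commute[of "rate _"] mult_left_mono)
  qed auto
  then show "rate x * (y - x) \<le> Rate y - Rate x" "Rate y - Rate x \<le> rate y * (y - x)"
    by auto
qed

text \<open>The substitution \<open>x = 1 - \<epsilon> + r * \<omega>\<close> turns the integral
  into one of \<open>rate\<close> over \<open>[1 - \<epsilon>, 1]\<close>, divided by
  \<open>r\<close>.\<close>

lemma I_const_eq_Rate: "r \<noteq> 0 \<Longrightarrow> I_const \<epsilon> r = (Rate 1 - Rate (1 - \<epsilon>)) / r"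
  by (simp add: I_const_def Rate_def power2_eq_square field_simps)

text \<open>A left Riemann sum of a nondecreasing function stays below the integral.\<close>

lemma sum_rate_le:
  assumes "0 < x" "0 < h" "x + real K * h \<le> 1"
  shows "(\<Sum>s<K. rate (x + real s * h)) \<le> (Rate (x + real K * h) - Rate x) / h"
  using assms(3)
proof (induction K)
  case (Suc K)
  have le: "x + real K * h \<le> x + real (Suc K) * h"
    using assms by (simp add: algebra_simps)
  have "0 < x + real K * h"
    using assms by (simp add: add_pos_nonneg)
  from Rate_diff_bounds(1)[OF this le Suc.prems]
  have "rate (x + real K * h) * h \<le> Rate (x + real (Suc K) * h) - Rate (x + real K * h)"
    by (simp add: algebra_simps)
  then have "rate (x + real K * h) \<le> (Rate (x + real (Suc K) * h) - Rate (x + real K * h)) / h"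
    using assms(2) by (simp add: pos_le_divide_eq)
  then show ?case
    using Suc.IH Suc.prems le by (simp add: diff_divide_distrib)
qed simp

section \<open>Subcritical exploration\<close>

text \<open>\<open>P\<close>, \<open>A\<close> and \<open>U\<close> are the processed, active and
  unseen vertices. \<open>Min\<close> merely fixes a deterministic choice of the vertex processed
  next.\<close>

primrec explores :: "(nat set \<Rightarrow> bool) \<Rightarrow> nat \<Rightarrow> nat set \<Rightarrow> nat set \<Rightarrow> nat set \<Rightarrow> bool" where
  "explores G 0 P A U = True"
| "explores G (Suc k) P A U = (A \<noteq> {} \<and>
     (\<lambda>C. explores G k (insert (Min A) P) (A - {Min A} \<union> C) (U - C)) (children G P {Min A} U))"

text \<open>An inspected edge contains the active vertex being processed and an unseen vertex, hence
  at least two vertices of \<open>A \<union> U\<close>; this set only shrinks.\<close>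

lemma determined_by_explores:
  assumes "finite A" "finite U" "P \<inter> A = {}" "(P \<union> A) \<inter> U = {}"
  shows "determined_by {e. 2 \<le> card (e \<inter> (A \<union> U))} (\<lambda>G. explores G k P A U)"
  using assms
proof (induction k arbitrary: P A U)
  case 0
  then show ?case by (simp add: determined_by_def)
next
  case (Suc k)
  show ?case
  proof (rule determined_byI)
    fix G G' :: "nat set \<Rightarrow> bool"
    assume G: "G e = G' e" if "e \<in> {e. 2 \<le> card (e \<inter> (A \<union> U))}" for e
    show "explores G (Suc k) P A U = explores G' (Suc k) P A U"
    proof (cases "A = {}")
      case False
      define u where "u = Min A"
      have u: "u \<in> A" using False Suc.prems by (simp add: u_def)
      have "G e = G' e" if "e \<in> links P {u} w" "w \<in> U" for e w
      proof (rule G)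
        have "u \<noteq> w" using u that Suc.prems by auto
        then have "2 = card {u, w}" by simp
        also have "\<dots> \<le> card (e \<inter> (A \<union> U))"
          using that u Suc.prems by (intro card_mono) (auto simp: links_def)
        finally show "e \<in> {e. 2 \<le> card (e \<inter> (A \<union> U))}" by simp
      qed
      then have C: "children G P {u} U = children G' P {u} U"
        by (auto simp: children_def)
      let ?C = "children G P {u} U"
      have CU: "?C \<subseteq> U" by (rule children_subset)
      have "explores G k (insert u P) (A - {u} \<union> ?C) (U - ?C) =
            explores G' k (insert u P) (A - {u} \<union> ?C) (U - ?C)"
      proof (rule determined_byD[OF Suc.IH])
        fix e assume "e \<in> {e. 2 \<le> card (e \<inter> (A - {u} \<union> ?C \<union> (U - ?C)))}"
        moreover have "card (e \<inter> (A - {u} \<union> ?C \<union> (U - ?C))) \<le> card (e \<inter> (A \<union> U))"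
          using CU Suc.prems by (intro card_mono) auto
        ultimately show "G e = G' e" by (intro G) simp
      qed (use u CU Suc.prems finite_subset[OF CU] in auto)
      then show ?thesis
        by (simp add: u_def[symmetric] C[symmetric])
    qed simp
  qed
qed

context hypergraph_model
begin

text \<open>The walk of active vertices is weighted at time \<open>s\<close> by the tilt \<open>1 / \<mu> s\<close> that turns the
  mean offspring \<open>\<mu> s\<close> into one. As \<open>\<mu>\<close> increases, the weights decrease, so survival at all times
  (not just at the end) keeps the weighted walk nonnegative.\<close>

lemma prob_explores_le:
  assumes \<mu>: "\<And>s. s \<le> K \<Longrightarrow> 0 < \<mu> s" "\<And>s. s \<le> K \<Longrightarrow> \<mu> s \<le> 1"
    and mono: "\<And>s. s < K \<Longrightarrow> \<mu> s \<le> \<mu> (Suc s)"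
    and hit: "\<And>s. s < K \<Longrightarrow> real n * hit s 1 \<le> \<mu> s"
    and "P \<union> A \<union> U \<subseteq> {..<n}" "P \<inter> A = {}" "(P \<union> A) \<inter> U = {}" "card P + k = K"
  shows "pr {G. explores G k P A U} \<le>
    (1 / \<mu> (card P)) ^ card A * (\<Prod>s=card P..<K. \<mu> s * exp (1 - \<mu> s))"
  using assms(5-)
proof (induction k arbitrary: P A U)
  case 0
  then have "1 \<le> (1 / \<mu> (card P)) ^ card A"
    using \<mu>[of K] by (intro one_le_power) simp
  with 0 show ?case
    by (simp add: measure_pmf.prob_space[simplified])
next
  case (Suc k)
  define t where "t = card P"
  have tK: "t < K" "Suc t \<le> K" using Suc.prems by (auto simp: t_def)
  have pos: "0 < \<mu> t" "0 < \<mu> (Suc t)" "\<mu> t \<le> 1" "\<mu> (Suc t) \<le> 1" using \<mu> tK by auto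
  have prod_nn: "0 \<le> (\<Prod>s=a..<K. \<mu> s * exp (1 - \<mu> s))" for a
    using \<mu>(1) by (intro prod_nonneg) (auto simp: less_imp_le)
  have fin: "finite P" "finite A" "finite U"
    using Suc.prems finite_subset[OF _ finite_lessThan] by blast+
  show ?case
  proof (cases "A = {}")
    case True
    then show ?thesis using prod_nn by simp
  next
    case False
    define u where "u = Min A"
    have u: "u \<in> A" using False fin by (simp add: u_def)
    define a where "a = card A - 1"
    have cA: "card A = Suc a" "card (A - {u}) = a"
      using u fin card_gt_0_iff[of A] by (auto simp: a_def)
    let ?R = "\<Prod>s=Suc t..<K. \<mu> s * exp (1 - \<mu> s)"
    let ?q = "hit t 1" and ?y = "1 / \<mu> t"
    have y: "1 \<le> ?y" using pos by simp
    have "pr {G. explores G (Suc k) P A U} =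
        pr {G. (\<lambda>C G. explores G k (insert u P) (A - {u} \<union> C) (U - C)) (children G P {u} U) G}"
      using False by (simp add: u_def)
    also have "\<dots> \<le> (\<Sum>C\<in>Pow U. hit (card P) (card {u}) ^ card C *
        (1 - hit (card P) (card {u})) ^ (card U - card C) *
        ((1 / \<mu> (Suc t)) ^ (a + card C) * ?R))"
    proof (rule prob_children_step_le)
      fix C assume C: "C \<subseteq> U"
      have "A - {u} \<union> C \<union> (U - C) = A - {u} \<union> U" using C by auto
      then show "determined_by {e. 2 \<le> card (e \<inter> (A - {u} \<union> U))}
          (\<lambda>G. explores G k (insert u P) (A - {u} \<union> C) (U - C))"
        using determined_by_explores[of "A - {u} \<union> C" "U - C" "insert u P" k]
          fin C Suc.prems u finite_subset[OF C] by auto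
      have "card (A - {u} \<union> C) = a + card C"
        using cA C fin Suc.prems finite_subset[OF C] by (subst card_Un_disjoint) auto
      moreover have "card (insert u P) = Suc t"
        using u fin Suc.prems by (auto simp: t_def card_insert_if)
      moreover have prem: "insert u P \<union> (A - {u} \<union> C) \<union> (U - C) \<subseteq> {..<n}"
        "insert u P \<inter> (A - {u} \<union> C) = {}" "(insert u P \<union> (A - {u} \<union> C)) \<inter> (U - C) = {}"
        "card (insert u P) + k = K"
        using Suc.prems u C \<open>card (insert u P) = Suc t\<close> by (auto simp: t_def)
      ultimately show "pr {G. explores G k (insert u P) (A - {u} \<union> C) (U - C)} \<le>
          (1 / \<mu> (Suc t)) ^ (a + card C) * ?R"
        using Suc.IH[of "insert u P" "A - {u} \<union> C" "U - C", OF prem] by simp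
    qed (use Suc.prems u in auto)
    \<comment> \<open>Since \<open>\<mu>\<close> is nondecreasing, replacing the next tilt by the
      current one only enlarges the weights. What remains is a binomial generating function at
      \<open>?y\<close>.\<close>
    also have "\<dots> \<le> (\<Sum>C\<in>Pow U. ?q ^ card C * (1 - ?q) ^ (card U - card C) *
        (?y ^ (a + card C) * ?R))"
      using hit_bounds[of t 1] prod_nn pos mono[OF tK(1)]
      by (auto simp: t_def[symmetric] intro!: sum_mono mult_left_mono mult_right_mono power_mono
            divide_left_mono)
    also have "\<dots> = ?y ^ a * ?R * (\<Sum>C\<in>Pow U. ?q ^ card C * (1 - ?q) ^ (card U - card C) * ?y ^ card C)"
      by (subst sum_distrib_left) (simp add: power_add mult_ac)
    also have "\<dots> = ?y ^ a * ?R * (1 + ?q * (?y - 1)) ^ card U"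
      by (simp only: sum_Pow_binomial[OF fin(3)])
    also have "\<dots> \<le> ?y ^ a * ?R * exp (1 - \<mu> t)"
    proof (rule mult_left_mono)
      show "0 \<le> ?y ^ a * ?R" 
        using pos by (intro mult_nonneg_nonneg prod_nn zero_le_power) simp
      have "card U \<le> n" using card_mono[of "{..<n}" U] Suc.prems by auto
      have nn: "0 \<le> ?q * (?y - 1)" using hit_bounds[of t 1] y by simp
      have "(1 + ?q * (?y - 1)) ^ card U \<le> (1 + ?q * (?y - 1)) ^ n"
        using nn \<open>card U \<le> n\<close> by (intro power_increasing) auto
      also have "\<dots> \<le> exp (?q * (?y - 1)) ^ n"
        using nn by (intro power_mono exp_ge_add_one_self) auto
      also have "\<dots> = exp (real n * ?q * (?y - 1))"
        by (simp add: exp_of_nat_mult[symmetric] mult.assoc)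
      also have "\<dots> \<le> exp (\<mu> t * (?y - 1))"
        using hit[OF tK(1)] y by (subst exp_le_cancel_iff) (intro mult_right_mono, auto)
      also have "\<mu> t * (?y - 1) = 1 - \<mu> t"
        using pos by (simp add: field_simps)
      finally show "(1 + ?q * (?y - 1)) ^ card U \<le> exp (1 - \<mu> t)" .
    qed
    also have "?y ^ a * ?R * exp (1 - \<mu> t) = ?y ^ card A * (\<Prod>s=t..<K. \<mu> s * exp (1 - \<mu> s))"
      using pos tK by (simp add: cA prod.atLeast_Suc_lessThan[of t K] field_simps)
    finally show ?thesis
      unfolding t_def .
  qed
qed

text \<open>Bernoulli's inequality, playing the part of a union bound over the \<open>1 + s\<close>
  links.\<close>

lemma n_hit_le: "real n * hit s 1 \<le> real n * (p2 + real s * p3)"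
proof -
  have "1 - p2 - real s * p3 \<le> (1 - p2) * (1 - real s * p3)"
    using p2 p3 by (simp add: algebra_simps)
  also have "\<dots> \<le> (1 - p2) * (1 - p3) ^ s"
    using p2 p3 Bernoulli_inequality[of "- p3" s] by (intro mult_left_mono) auto
  finally show ?thesis
    by (intro mult_left_mono) (auto simp: hit_def)
qed

end

section \<open>Closed sets and the death of an exploration\<close>

definition propagation_closed :: "'a set set \<Rightarrow> 'a set \<Rightarrow> bool" where
  "propagation_closed E S \<longleftrightarrow> (\<forall>e\<in>E. card (e \<inter> S) = card e - 1 \<longrightarrow> e \<subseteq> S)"

text \<open>Each edge after the first adds exactly one vertex, so counting forces the first edge to
  be a pair \<open>{a, b}\<close> and the edges to cover \<open>V\<close>. A closed set containing
  \<open>a\<close> absorbs this pair and then all later edges in turn.\<close>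

lemma propagation_connected_imp_root:
  assumes pc: "propagation_connected V E" and V: "finite V" "2 \<le> card V"
    and E: "\<And>e. e \<in> E \<Longrightarrow> e \<subseteq> V \<and> 2 \<le> card e"
  obtains v where "v \<in> V" "\<And>S. v \<in> S \<Longrightarrow> propagation_closed E S \<Longrightarrow> V \<subseteq> S"
proof -
  obtain e where e: "\<And>i. i \<in> {1..card V - 1} \<Longrightarrow> e i \<in> E"
    and step: "\<And>l. l \<in> {1..card V - 2} \<Longrightarrow>
      card (e (l + 1) \<inter> (\<Union>i\<in>{1..l}. e i)) = card (e (l + 1)) - 1"
    using pc unfolding propagation_connected_def by blast
  have fin: "finite (e i)" if "i \<in> {1..card V - 1}" for i
    using E[OF e[OF that]] V finite_subset by blast
  have card_U: "card (\<Union>i\<in>{1..Suc l}. e i) = card (e 1) + l" if "Suc l \<le> card V - 1" for l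
    using that
  proof (induction l)
    case (Suc l)
    let ?U = "\<Union>i\<in>{1..Suc l}. e i" and ?e = "e (Suc (Suc l))"
    have fU: "finite ?U" using fin Suc.prems by auto
    have fe: "finite ?e" "2 \<le> card ?e" using fin E[OF e] Suc.prems by auto
    have "card (?e \<inter> ?U) = card ?e - 1"
      using step[of "Suc l"] Suc.prems by auto
    moreover have "card ?U + card ?e = card (?U \<union> ?e) + card (?U \<inter> ?e)"
      by (rule card_Un_Int[OF fU fe(1)])
    moreover have "(\<Union>i\<in>{1..Suc (Suc l)}. e i) = ?U \<union> ?e"
      by (auto simp: atLeastAtMostSuc_conv)
    ultimately show ?case
      using Suc.IH Suc.prems fe(2) by (simp add: Int_commute)
  qed simp
  let ?U = "\<Union>i\<in>{1..card V - 1}. e i"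
  have UV: "?U \<subseteq> V" using E[OF e] by blast
  have V1: "card V - 1 = Suc (card V - 2)" using V(2) by linarith
  have "card ?U = card (e 1) + (card V - 2)"
    unfolding V1 by (rule card_U) (simp only: V1)
  moreover have "card ?U \<le> card V" by (rule card_mono[OF V(1) UV])
  moreover have e1: "e 1 \<subseteq> V" "2 \<le> card (e 1)" using E[OF e[of 1]] V(2) by auto
  ultimately have c1: "card (e 1) = 2" and "card ?U = card V" using V(2) by auto
  then have U_eq: "?U = V" using card_subset_eq[OF V(1) UV] by simp
  obtain a b where ab: "e 1 = {a, b}" "a \<noteq> b" using c1 by (meson card_2_iff)
  show thesis
  proof (rule that[of a])
    show "a \<in> V" using ab e1 by auto
    fix S assume S: "a \<in> S" "propagation_closed E S"
    have "(\<Union>i\<in>{1..Suc l}. e i) \<subseteq> S" if "Suc l \<le> card V - 1" for l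
      using that
    proof (induction l)
      case 0
      have "b \<in> S"
      proof (rule ccontr)
        assume "b \<notin> S"
        then have "e 1 \<inter> S = {a}" using ab S by auto
        then have "e 1 \<subseteq> S"
          using S(2) e[of 1] c1 V(2) unfolding propagation_closed_def by auto
        then show False using \<open>b \<notin> S\<close> ab by auto
      qed
      then show ?case using ab S by simp
    next
      case (Suc l)
      let ?U = "\<Union>i\<in>{1..Suc l}. e i" and ?e = "e (Suc (Suc l))"
      have U: "?U \<subseteq> S" using Suc by simp
      have fe: "finite ?e" "?e \<in> E" using fin e Suc.prems by auto
      \<comment> \<open>At most one vertex of the edge is outside \<open>S\<close>: if there is one,
        closedness applies, otherwise the edge is already inside.\<close>
      have "card ?e - 1 \<le> card (?e \<inter> S)"
        using step[of "Suc l"] Suc.prems U fe card_mono[of "?e \<inter> S" "?e \<inter> ?U"] by auto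
      moreover have "card (?e \<inter> S) \<le> card ?e" using fe by (intro card_mono) auto
      ultimately consider "card (?e \<inter> S) = card ?e - 1" | "card (?e \<inter> S) = card ?e" by linarith
      then have "?e \<subseteq> S"
      proof cases
        case 1
        then show ?thesis using S(2) fe unfolding propagation_closed_def by blast
      next
        case 2
        then have "?e \<inter> S = ?e" using fe by (intro card_subset_eq) auto
        then show ?thesis by blast
      qed
      then show ?case using U by (auto simp: atLeastAtMostSuc_conv)
    qed
    from this[of "card V - 2"] show "V \<subseteq> S"
      using U_eq unfolding V1 by (simp only: V1)
  qed
qed

text \<open>The invariant is that no edge leads from \<open>P\<close> to a single vertex of
  \<open>U\<close>. When the active set runs empty, all other vertices are in \<open>U\<close>, so
  \<open>P\<close> is the closed set sought.\<close>

lemma not_explores_imp_closed: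
  assumes "\<not> explores G k P A U" "P \<inter> A = {}" "(P \<union> A) \<inter> U = {}" "P \<union> A \<union> U = V" "finite V"
    and E: "\<And>e. G e \<Longrightarrow> e \<subseteq> V \<and> (card e = 2 \<or> card e = 3)"
    and "\<And>p w. p \<in> P \<Longrightarrow> w \<in> U \<Longrightarrow> \<not> G {p, w}"
    and "\<And>p p' w. p \<in> P \<Longrightarrow> p' \<in> P \<Longrightarrow> w \<in> U \<Longrightarrow> p \<noteq> p' \<Longrightarrow> \<not> G {p, p', w}"
    and "card P + k \<le> card V"
  shows "\<exists>S. P \<union> A \<subseteq> S \<and> \<not> V \<subseteq> S \<and> propagation_closed {e. G e} S"
  using assms(1-5,7-)
proof (induction k arbitrary: P A U)
  case (Suc k)
  show ?case
  proof (cases "A = {}")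
    case True
    \<comment> \<open>The budget of remaining steps gives \<open>card P < card V\<close>.\<close>
    have "\<not> V \<subseteq> P"
    proof
      assume "V \<subseteq> P"
      then have "card V \<le> card P" using Suc.prems by (intro card_mono) (auto intro: finite_subset)
      then show False using Suc.prems by simp
    qed
    moreover have "propagation_closed {e. G e} P"
      unfolding propagation_closed_def
    proof (intro ballI impI, rule ccontr)
      fix e assume e: "e \<in> {e. G e}" "card (e \<inter> P) = card e - 1" "\<not> e \<subseteq> P"
      then have eV: "e \<subseteq> V" "card e = 2 \<or> card e = 3" using E by auto
      obtain w where w: "w \<in> e" "w \<notin> P" using e by auto
      then have wU: "w \<in> U" using eV Suc.prems True by auto
      have "finite e" using eV Suc.prems finite_subset by blast
      have "e \<inter> P \<subseteq> e - {w}" using w by auto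
      moreover have "card (e - {w}) = card e - 1" using w \<open>finite e\<close> by simp
      ultimately have eP: "e \<inter> P = e - {w}"
        using e(2) \<open>finite e\<close> by (intro card_subset_eq) auto
      from eV(2) show False
      proof
        assume "card e = 2"
        then obtain p where "e \<inter> P = {p}" using e(2) by (auto simp: card_1_singleton_iff)
        then have "e = {p, w}" "p \<in> P" using eP w by auto
        then show False using e Suc.prems(6) wU by auto
      next
        assume "card e = 3"
        then obtain p p' where "e \<inter> P = {p, p'}" "p \<noteq> p'" using e(2) by (auto simp: card_2_iff)
        then have "e = {p, p', w}" "p \<in> P" "p' \<in> P" "p \<noteq> p'" using eP w by auto
        then show False using e Suc.prems(7) wU by auto
      qed
    qed
    ultimately show ?thesis using True by auto
  next
    case False
    have fin: "finite A" "finite P" using Suc.prems finite_subset by auto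
    define u where "u = Min A"
    have u: "u \<in> A" using False fin by (simp add: u_def)
    define C where "C = children G P {u} U"
    have CU: "C \<subseteq> U" by (simp add: C_def children_subset)
    have uw: "\<not> G {u, w}" "p \<in> P \<Longrightarrow> \<not> G {u, p, w}" if "w \<in> U - C" for p w
      using that by (auto simp: C_def children_def links_def)
    have "\<exists>S. insert u P \<union> (A - {u} \<union> C) \<subseteq> S \<and> \<not> V \<subseteq> S \<and> propagation_closed {e. G e} S"
    proof (rule Suc.IH)
      show "\<not> explores G k (insert u P) (A - {u} \<union> C) (U - C)"
        using Suc.prems(1) False by (simp add: u_def C_def)
      show "card (insert u P) + k \<le> card V"
        using Suc.prems(8) fin by (simp add: card_insert_if)
      show "\<not> G {p, w}" if "p \<in> insert u P" "w \<in> U - C" for p w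
        using that uw Suc.prems(6) by auto
      show "\<not> G {p, p', w}" if "p \<in> insert u P" "p' \<in> insert u P" "w \<in> U - C" "p \<noteq> p'" for p p' w
        using that uw(2)[of w] Suc.prems(7)[of p p' w] by (auto simp: insert_commute)
    qed (use Suc.prems u CU in auto)
    then show ?thesis using u by blast
  qed
qed simp

text \<open>An exploration dying from the root would produce a proper closed set containing
  it.\<close>

lemma propagation_connected_imp_explores:
  assumes pc: "propagation_connected {..<n} {e. G e}" and "2 \<le> n" "k \<le> n"
    and E: "\<And>e. G e \<Longrightarrow> e \<in> edges2 n \<union> edges3 n"
  shows "\<exists>v<n. explores G k {} {v} ({..<n} - {v})"
proof -
  have E': "e \<subseteq> {..<n} \<and> (card e = 2 \<or> card e = 3)" if "G e" for e
    using E[OF that] by (auto simp: edges2_def edges3_def)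
  obtain v where v: "v < n" "\<And>S. v \<in> S \<Longrightarrow> propagation_closed {e. G e} S \<Longrightarrow> {..<n} \<subseteq> S"
  proof (rule propagation_connected_imp_root[OF pc])
    show "e \<subseteq> {..<n} \<and> 2 \<le> card e" if "e \<in> {e. G e}" for e
      using E'[of e] that by auto
  qed (use \<open>2 \<le> n\<close> in auto)
  have "explores G k {} {v} ({..<n} - {v})"
  proof (rule ccontr)
    assume "\<not> explores G k {} {v} ({..<n} - {v})"
    then have "\<exists>S. {} \<union> {v} \<subseteq> S \<and> \<not> {..<n} \<subseteq> S \<and> propagation_closed {e. G e} S"
      by (rule not_explores_imp_closed) (use v E' \<open>k \<le> n\<close> in auto)
    then show False using v(2) by auto
  qed
  then show ?thesis using v by blast
qed

text \<open>Union bound over the \<open>n\<close> start vertices. The mean offspring after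
  \<open>s\<close> steps is at most \<open>x + s * h\<close>, and \<open>K\<close> is chosen so that
  step \<open>K\<close> lies within \<open>h\<close> of criticality.\<close>

lemma (in hypergraph_model) prob_propagation_connected_le:
  assumes "2 \<le> n" "K \<le> n" "0 < x" "0 < h" "x + real K * h \<le> 1" "1 \<le> x + real (Suc K) * h"
    and hit: "\<And>s. real n * (p2 + real s * p3) = x + real s * h"
  shows "pr {G. propagation_connected {..<n} {e. G e}} \<le>
    real n / x * exp ((Rate 1 - Rate x) / h - rate x)"
proof -
  define \<mu> where "\<mu> s = x + real s * h" for s
  have \<mu>: "0 < \<mu> s" "\<mu> s \<le> \<mu> (Suc s)" for s
    using assms by (auto simp: \<mu>_def algebra_simps intro: add_pos_nonneg)
  have \<mu>1: "\<mu> s \<le> 1" if "s \<le> K" for s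
  proof -
    have "real s * h \<le> real K * h" using that \<open>0 < h\<close> by (intro mult_right_mono) auto
    then show ?thesis using assms(5) unfolding \<mu>_def by linarith
  qed
  let ?R = "exp ((Rate 1 - Rate x) / h - rate x)"
  have "(\<Prod>s=0..<K. \<mu> s * exp (1 - \<mu> s)) = exp (\<Sum>s<K. rate (\<mu> s))"
    unfolding exp_sum[OF finite_lessThan] atLeast0LessThan
    using \<mu> by (intro prod.cong) (auto simp: rate_def exp_add exp_diff)
  also have "\<dots> \<le> ?R"
  proof (subst exp_le_cancel_iff)
    have "(\<Sum>s<K. rate (\<mu> s)) \<le> (Rate (\<mu> K) - Rate x) / h"
      unfolding \<mu>_def using assms by (intro sum_rate_le)
    also have "Rate (\<mu> K) \<le> Rate 1 - rate x * h"
    proof -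
      \<comment> \<open>The Riemann sum ends at \<open>\<mu> K\<close>; the missing piece up to 1
        has length at most \<open>h\<close> and is paid for by the correction
        \<open>- rate x\<close> in the exponent.\<close>
      have "rate x * h \<le> rate (\<mu> K) * (1 - \<mu> K)"
      proof -
        have "rate x \<le> rate (\<mu> K)"
          using assms \<mu>1[of K] by (intro rate_mono) (auto simp: \<mu>_def)
        then have "rate x * h \<le> rate (\<mu> K) * h"
          using \<open>0 < h\<close> by simp
        also have "\<dots> \<le> rate (\<mu> K) * (1 - \<mu> K)"
          using assms rate_nonpos[OF \<mu>(1)] by (intro mult_left_mono_neg) (auto simp: \<mu>_def algebra_simps)
        finally show ?thesis .
      qed
      also have "\<dots> \<le> Rate 1 - Rate (\<mu> K)"
        by (rule Rate_diff_bounds) (use \<mu> \<mu>1 in auto)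
      finally show ?thesis by simp
    qed
    then have "(Rate (\<mu> K) - Rate x) / h \<le> (Rate 1 - rate x * h - Rate x) / h"
      using \<open>0 < h\<close> by (simp add: divide_right_mono)
    also have "\<dots> = (Rate 1 - Rate x) / h - rate x"
      using \<open>0 < h\<close> by (simp add: field_simps)
    finally show "(\<Sum>s<K. rate (\<mu> s)) \<le> (Rate 1 - Rate x) / h - rate x" .
  qed
  finally have prod: "(\<Prod>s=0..<K. \<mu> s * exp (1 - \<mu> s)) \<le> ?R" .
  have one: "pr {G. explores G K {} {v} ({..<n} - {v})} \<le> 1 / x * ?R" if "v < n" for v
  proof -
    have "pr {G. explores G K {} {v} ({..<n} - {v})} \<le>
        (1 / \<mu> (card ({} :: nat set))) ^ card {v} * (\<Prod>s=card ({} :: nat set)..<K. \<mu> s * exp (1 - \<mu> s))"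
    proof (rule prob_explores_le[of K \<mu> "{}" "{v}"])
      show "real n * hit s 1 \<le> \<mu> s" for s
        using n_hit_le[of s] by (simp add: \<mu>_def hit)
    qed (use \<mu> \<mu>1 that in auto)
    also have "\<dots> \<le> 1 / x * ?R"
      using prod \<open>0 < x\<close> by (simp add: \<mu>_def divide_right_mono)
    finally show ?thesis .
  qed
  have "pr {G. propagation_connected {..<n} {e. G e}} \<le>
      pr {G. \<exists>v<n. explores G K {} {v} ({..<n} - {v})}"
    by (rule prob_support) (use assms propagation_connected_imp_explores in blast)
  also have "{G. \<exists>v<n. explores G K {} {v} ({..<n} - {v})} =
      (\<Union>v\<in>{..<n}. {G. explores G K {} {v} ({..<n} - {v})})"
    by auto
  also have "pr \<dots> \<le> (\<Sum>v\<in>{..<n}. pr {G. explores G K {} {v} ({..<n} - {v})})"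
    by (intro measure_pmf.finite_measure_subadditive_finite) auto
  also have "\<dots> \<le> (\<Sum>v\<in>{..<n}. 1 / x * ?R)"
    using one by (intro sum_mono) auto
  finally show ?thesis by simp
qed

section \<open>Asymptotics of the disconnected case\<close>

lemma eventually_hypergraph_model:
  fixes \<epsilon> r :: real
  assumes "0 < \<epsilon>" "\<epsilon> < 1" "0 < r"
  shows "\<forall>\<^sub>F n in sequentially. hypergraph_model ((1 - \<epsilon>) / real n) (r / (real n * ln (real n)))"
proof -
  have "\<forall>\<^sub>F n in sequentially. r / (real n * ln (real n)) < 1"
    by real_asymp
  moreover have "\<forall>\<^sub>F n in sequentially. (1 - \<epsilon>) / real n < 1"
    by real_asymp
  ultimately show ?thesis
    using eventually_gt_at_top[of 1]
  proof eventually_elim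
    case (elim n)
    then show ?case
      using assms by unfold_locales auto
  qed
qed

lemma prob_propagation_connected_tendsto_0:
  fixes \<epsilon> r :: real
  assumes "0 < \<epsilon>" "\<epsilon> < 1" "0 < r" and I: "I_const \<epsilon> r < -1"
  shows "(\<lambda>n. measure_pmf.prob (random_hypergraph n ((1 - \<epsilon>) / real n) (r / (real n * ln (real n))))
    {G. propagation_connected {..<n} {e. G e}}) \<longlonglongrightarrow> 0"
proof (rule tendsto_sandwich[OF _ _ tendsto_const])
  let ?x = "1 - \<epsilon>"
  \<comment> \<open>A constant times \<open>n powr (1 + I)\<close>, the number of start vertices
    times the survival probability.\<close>
  let ?B = "\<lambda>n. exp (- rate ?x) / ?x * exp ((1 + I_const \<epsilon> r) * ln (real n))"
  have "filterlim (\<lambda>n. ln (real n)) at_top sequentially"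
    by real_asymp
  then have "filterlim (\<lambda>n. (1 + I_const \<epsilon> r) * ln (real n)) at_bot sequentially"
    using I by (intro filterlim_tendsto_neg_mult_at_bot[OF tendsto_const]) auto
  then have "(\<lambda>n. exp ((1 + I_const \<epsilon> r) * ln (real n))) \<longlonglongrightarrow> 0"
    by (rule filterlim_compose[OF exp_at_bot])
  then show "?B \<longlonglongrightarrow> 0"
    by (rule tendsto_mult_right_zero)
  have "\<forall>\<^sub>F n in sequentially. \<epsilon> / r * ln (real n) < real n"
    by real_asymp
  then show "\<forall>\<^sub>F n in sequentially. measure_pmf.prob
      (random_hypergraph n ((1 - \<epsilon>) / real n) (r / (real n * ln (real n))))
      {G. propagation_connected {..<n} {e. G e}} \<le> ?B n"
    using eventually_hypergraph_model[OF assms(1-3)] eventually_gt_at_top[of 1]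
  proof eventually_elim
    case (elim n)
    interpret hypergraph_model n "?x / real n" "r / (real n * ln (real n))" by fact
    define L where "L = ln (real n)"
    have L: "0 < L" using elim by (simp add: L_def)
    \<comment> \<open>The number of steps until the mean offspring
      \<open>1 - \<epsilon> + s * (r / L)\<close> reaches 1.\<close>
    define K where "K = nat \<lfloor>\<epsilon> / r * L\<rfloor>"
    have K: "real K \<le> \<epsilon> / r * L" "\<epsilon> / r * L \<le> real (Suc K)"
      using assms L real_of_int_floor_add_one_ge[of "\<epsilon> / r * L"] by (auto simp: K_def add.commute)
    have "pr {G. propagation_connected {..<n} {e. G e}} \<le>
        real n / ?x * exp ((Rate 1 - Rate ?x) / (r / L) - rate ?x)"
    proof (rule prob_propagation_connected_le)
      show "?x + real K * (r / L) \<le> 1" "1 \<le> ?x + real (Suc K) * (r / L)"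
        using K assms L by (simp_all add: field_simps)
      show "real n * (?x / real n + real s * (r / (real n * ln (real n)))) = ?x + real s * (r / L)" for s
        using elim L by (simp add: L_def field_simps)
      show "K \<le> n" using K(1) elim unfolding L_def by linarith
    qed (use elim assms L in auto)
    also have "(Rate 1 - Rate ?x) / (r / L) = I_const \<epsilon> r * L"
      using assms L by (simp add: I_const_eq_Rate field_simps)
    also have "real n / ?x * exp (I_const \<epsilon> r * L - rate ?x) = ?B n"
      using elim by (simp add: L_def algebra_simps exp_add exp_diff exp_minus field_simps)
    finally show ?case .
  qed
qed simp

section \<open>Binomial tails\<close>

text \<open>The probability of at least \<open>b\<close> successes in \<open>u\<close> trials,
  conditioned on one trial. The recursion makes the comparison results plain inductions.\<close>

fun binomial_tail :: "nat \<Rightarrow> real \<Rightarrow> nat \<Rightarrow> real" where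
  "binomial_tail u q 0 = 1"
| "binomial_tail 0 q (Suc b) = 0"
| "binomial_tail (Suc u) q (Suc b) = q * binomial_tail u q b + (1 - q) * binomial_tail u q (Suc b)"

lemma binomial_tail_bounds:
  assumes "0 \<le> q" "q \<le> 1"
  shows "0 \<le> binomial_tail u q b \<and> binomial_tail u q b \<le> 1"
  using assms
  by (induction u q b rule: binomial_tail.induct) (auto intro: convex_bound_le)

lemma binomial_tail_Suc_le:
  assumes "0 \<le> q" "q \<le> 1"
  shows "binomial_tail u q (Suc b) \<le> binomial_tail u q b"
proof (induction u arbitrary: b)
  case 0
  then show ?case by (cases b) auto
next
  case (Suc u)
  then show ?case
    using assms binomial_tail_bounds[OF assms, of "Suc u" "Suc 0"]
    by (cases b) (auto intro!: add_mono mult_left_mono)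
qed

lemma binomial_tail_mono_left:
  assumes "0 \<le> q" "q \<le> 1" "u \<le> u'"
  shows "binomial_tail u q b \<le> binomial_tail u' q b"
proof (rule lift_Suc_mono_le[OF _ \<open>u \<le> u'\<close>])
  fix u show "binomial_tail u q b \<le> binomial_tail (Suc u) q b"
  proof (cases b)
    case (Suc c)
    have "q * binomial_tail u q (Suc c) \<le> q * binomial_tail u q c"
      using assms by (intro mult_left_mono binomial_tail_Suc_le) auto
    then show ?thesis using Suc by (simp add: algebra_simps)
  qed simp
qed

text \<open>A larger success probability moves weight to the success branch, which has the larger
  tail.\<close>

lemma binomial_tail_mono_prob:
  assumes "0 \<le> q" "q \<le> q'" "q' \<le> 1"
  shows "binomial_tail u q b \<le> binomial_tail u q' b"
proof (induction u arbitrary: b)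
  case 0
  then show ?case by (cases b) auto
next
  case (Suc u)
  show ?case
  proof (cases b)
    case (Suc c)
    have "(q' - q) * binomial_tail u q (Suc c) \<le> (q' - q) * binomial_tail u q c"
      using assms by (intro mult_left_mono binomial_tail_Suc_le) auto
    then have "binomial_tail (Suc u) q b \<le> q' * binomial_tail u q c + (1 - q') * binomial_tail u q (Suc c)"
      using Suc by (simp add: algebra_simps)
    also have "\<dots> \<le> binomial_tail (Suc u) q' b"
      using assms Suc by (auto intro!: add_mono mult_left_mono Suc.IH)
    finally show ?thesis .
  qed simp
qed

text \<open>Splitting the subsets by whether they contain a fixed element reproduces the
  recursion.\<close>

lemma sum_Pow_binomial_tail:
  assumes "finite U"
  shows "(\<Sum>C\<in>Pow U. q ^ card C * (1 - q) ^ (card U - card C) * (if b \<le> card C then 1 else 0)) =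
    binomial_tail (card U) q b"
  using assms
proof (induction U arbitrary: b rule: finite_induct)
  case empty
  then show ?case by (cases b) auto
next
  case (insert x U)
  show ?case
  proof (cases b)
    case 0
    then show ?thesis
      using sum_Pow_binomial[of "insert x U" q 1] insert by simp
  next
    case (Suc c)
    let ?w = "\<lambda>C. q ^ card C * (1 - q) ^ (card U - card C)"
    have fin: "finite C" "x \<notin> C" "card C \<le> card U" if "C \<in> Pow U" for C
      using that insert.hyps by (auto intro: finite_subset card_mono)
    have "(\<Sum>C\<in>Pow (insert x U). q ^ card C * (1 - q) ^ (card (insert x U) - card C) * (if b \<le> card C then 1 else 0)) =
      (\<Sum>C\<in>Pow U. (1 - q) * (?w C * (if b \<le> card C then 1 else 0))) +
      (\<Sum>C\<in>Pow U. q * (?w C * (if c \<le> card C then 1 else 0)))"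
      using insert.hyps fin Suc unfolding sum_Pow_insert[OF insert.hyps]
      by (intro arg_cong2[where f = "(+)"] sum.cong) (auto simp: Suc_diff_le)
    also have "\<dots> = binomial_tail (card (insert x U)) q b"
      using insert.IH[of b] insert.IH[of c] insert.hyps Suc
      by (simp add: sum_distrib_left[symmetric])
    finally show ?thesis .
  qed
qed

lemma binomial_tail_ge_point:
  assumes "0 \<le> q" "q \<le> 1" "b \<le> u"
  shows "real (u choose b) * q ^ b * (1 - q) ^ (u - b) \<le> binomial_tail u q b"
  using assms(3)
proof (induction u arbitrary: b)
  case (Suc u)
  show ?case
  proof (cases b)
    case 0
    then show ?thesis using assms by (simp add: mult_le_one power_le_one)
  next
    case (Suc c)
    have 1: "real (u choose c) * q ^ c * (1 - q) ^ (u - c) \<le> binomial_tail u q c"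
      using Suc Suc.prems by (intro Suc.IH) auto
    have 2: "real (u choose Suc c) * q ^ Suc c * (1 - q) ^ (u - c) \<le> (1 - q) * binomial_tail u q (Suc c)"
    proof (cases "Suc c \<le> u")
      case True
      then have "(1 - q) ^ (u - c) = (1 - q) * (1 - q) ^ (u - Suc c)"
        by (simp add: Suc_diff_Suc flip: power_Suc)
      then show ?thesis
        using mult_left_mono[OF Suc.IH[OF True], of "1 - q"] assms by (simp add: mult_ac)
    next
      case False
      then have "u choose Suc c = 0" by simp
      then show ?thesis using assms binomial_tail_bounds[of q u "Suc c"] by (simp only:) simp
    qed
    show ?thesis
      using mult_left_mono[OF 1, of q] 2 assms Suc by (simp add: algebra_simps)
  qed
qed simp

lemma power_diff_le_fact_binomial:
  assumes "j \<le> b" "b \<le> u"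
  shows "(u - b) ^ j \<le> fact j * (u choose j)"
  using assms(1)
proof (induction j)
  case (Suc j)
  have "(u - b) ^ Suc j \<le> (u - j) * (fact j * (u choose j))"
    unfolding power_Suc using Suc by (intro mult_mono) auto
  also have "\<dots> = fact j * ((u choose j) * (u - j))"
    by (simp add: mult_ac)
  also have "(u choose j) * (u - j) = Suc j * (u choose Suc j)"
    using binomial_absorb_comp[of u j] binomial_absorption[of j u] by (simp add: mult.commute)
  finally show ?case by (simp add: algebra_simps)
qed simp

text \<open>Only the term with exactly \<open>b\<close> successes is kept, and the binomial
  coefficient is bounded by \<open>(u - b) ^ b / fact b\<close>.\<close>

lemma binomial_tail_ge:
  assumes "0 \<le> q" "q \<le> 1" "b \<le> u"
  shows "((real u - real b) * q) ^ b / fact b * (1 - q) ^ u \<le> binomial_tail u q b"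
proof -
  have "real ((u - b) ^ b) \<le> real (fact b * (u choose b))"
    using power_diff_le_fact_binomial[of b b u] assms by (intro of_nat_mono) auto
  then have "(real u - real b) ^ b / fact b \<le> real (u choose b)"
    using assms by (simp add: of_nat_diff divide_le_eq mult.commute)
  then have "(real u - real b) ^ b / fact b * q ^ b * (1 - q) ^ u \<le>
      real (u choose b) * q ^ b * (1 - q) ^ (u - b)"
    using assms by (intro mult_mono power_decreasing) auto
  also have "\<dots> \<le> binomial_tail u q b"
    by (rule binomial_tail_ge_point[OF assms])
  finally show ?thesis by (simp add: power_mult_distrib)
qed

text \<open>A Chernoff bound: for the number \<open>X\<close> of successes, Markov's inequality for
  \<open>2 powr (- X)\<close> gives the right-hand side. The proof follows the recursion
  instead.\<close>

lemma one_minus_binomial_tail_le: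
  assumes "0 \<le> q" "q \<le> 1"
  shows "1 - binomial_tail u q b \<le> 2 ^ b * (1 - q / 2) ^ u"
  using assms
proof (induction u q b rule: binomial_tail.induct)
  case (2 q b)
  have "1 \<le> (2 :: real) ^ Suc b" by (rule one_le_power) simp
  then show ?case by simp
next
  case (3 u q b)
  let ?r = "(1 - q / 2) ^ u"
  have "1 - binomial_tail (Suc u) q (Suc b) =
      q * (1 - binomial_tail u q b) + (1 - q) * (1 - binomial_tail u q (Suc b))"
    by (simp add: algebra_simps)
  also have "\<dots> \<le> q * (2 ^ b * ?r) + (1 - q) * (2 ^ Suc b * ?r)"
    using 3 by (intro add_mono mult_left_mono) auto
  also have "\<dots> = 2 ^ Suc b * (1 - q / 2) ^ Suc u"
    by (simp add: algebra_simps)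
  finally show ?case .
qed auto

section \<open>Growing in blocks\<close>

text \<open>A choice depending on \<open>C\<close> alone, so that the next state is a function of
  the edges inspected so far.\<close>

definition pick :: "nat \<Rightarrow> 'a set \<Rightarrow> 'a set" where
  "pick b C = (SOME B. B \<subseteq> C \<and> card B = b)"

lemma pick:
  assumes "b \<le> card C"
  shows "pick b C \<subseteq> C" "card (pick b C) = b"
proof -
  obtain B where "B \<subseteq> C \<and> card B = b"
    using obtain_subset_with_card_n[OF assms] by metis
  then have "pick b C \<subseteq> C \<and> card (pick b C) = b"
    unfolding pick_def by (rule someI)
  then show "pick b C \<subseteq> C" "card (pick b C) = b" by auto
qed

text \<open>The list contains the prescribed block sizes. Surplus children stay in \<open>U\<close>, which keeps all
  set sizes deterministic. When a block falls short, its vertices are discarded and the fallback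
  \<open>fb\<close> continues inside \<open>U\<close>.\<close>

primrec grow :: "((nat set \<Rightarrow> bool) \<Rightarrow> nat set \<Rightarrow> bool) \<Rightarrow> (nat set \<Rightarrow> bool) \<Rightarrow> nat list \<Rightarrow>
    nat set \<Rightarrow> nat set \<Rightarrow> nat set \<Rightarrow> bool" where
  "grow fb G [] P A U = True"
| "grow fb G (b # bs) P A U =
    (\<lambda>C. if b \<le> card C then grow fb G bs (P \<union> A) (pick b C) (U - pick b C) else fb G U)
      (children G P A U)"

text \<open>The remaining attempts are handed to \<open>grow\<close> as its fallback, so a failure
  restarts from a new root among the vertices still in \<open>U\<close>.\<close>

primrec attempts :: "nat list \<Rightarrow> nat \<Rightarrow> (nat set \<Rightarrow> bool) \<Rightarrow> nat set \<Rightarrow> bool" where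
  "attempts bs 0 = (\<lambda>G U. False)"
| "attempts bs (Suc N) = (\<lambda>G U. U \<noteq> {} \<and> grow (attempts bs N) G bs {} {Min U} (U - {Min U}))"

text \<open>An inspected edge has a vertex in the current block and one in \<open>U\<close>; later
  blocks and the fallback stay inside \<open>U\<close>.\<close>

lemma determined_by_grow:
  assumes fb: "\<And>U. finite U \<Longrightarrow> determined_by {e. 2 \<le> card (e \<inter> U)} (\<lambda>G. fb G U)"
    and "finite A" "finite U" "P \<inter> A = {}" "(P \<union> A) \<inter> U = {}"
  shows "determined_by {e. 2 \<le> card (e \<inter> (A \<union> U))} (\<lambda>G. grow fb G bs P A U)"
  using assms(2-)
proof (induction bs arbitrary: P A U)
  case Nil
  then show ?case by (simp add: determined_by_def)
next
  case (Cons b bs)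
  show ?case
  proof (rule determined_byI)
    fix G G' :: "nat set \<Rightarrow> bool"
    assume G: "G e = G' e" if "e \<in> {e. 2 \<le> card (e \<inter> (A \<union> U))}" for e
    have "G e = G' e" if ew: "e \<in> links P A w" "w \<in> U" for e w
    proof (rule G)
      obtain u where u: "u \<in> A" "u \<in> e" "w \<in> e"
        using ew by (auto simp: links_def)
      then have "u \<noteq> w" using ew Cons.prems by auto
      have "card {u, w} \<le> card (e \<inter> (A \<union> U))"
        using Cons.prems u ew by (intro card_mono) auto
      then show "e \<in> {e. 2 \<le> card (e \<inter> (A \<union> U))}" using \<open>u \<noteq> w\<close> by simp
    qed
    then have C: "children G P A U = children G' P A U"
      by (auto simp: children_def)
    let ?C = "children G P A U"
    have GU: "G e = G' e" if "e \<in> {e. 2 \<le> card (e \<inter> U)}" for e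
    proof (rule G)
      have "card (e \<inter> U) \<le> card (e \<inter> (A \<union> U))"
        using Cons.prems by (intro card_mono) auto
      then show "e \<in> {e. 2 \<le> card (e \<inter> (A \<union> U))}" using that by simp
    qed
    show "grow fb G (b # bs) P A U = grow fb G' (b # bs) P A U"
    proof (cases "b \<le> card ?C")
      case True
      let ?B = "pick b ?C"
      have B: "?B \<subseteq> U" by (rule subset_trans[OF pick(1)[OF True] children_subset])
      have "grow fb G bs (P \<union> A) ?B (U - ?B) = grow fb G' bs (P \<union> A) ?B (U - ?B)"
      proof (rule determined_byD[OF Cons.IH])
        have "?B \<union> (U - ?B) = U" using B by auto
        then show "G e = G' e" if "e \<in> {e. 2 \<le> card (e \<inter> (?B \<union> (U - ?B)))}" for e
          using GU that by simp
      qed (use Cons.prems B finite_subset[OF B] in auto)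
      then show ?thesis using True C by simp
    next
      case False
      then show ?thesis
        using C determined_byD[OF fb[OF Cons.prems(2)] GU] by simp
    qed
  qed
qed

lemma determined_by_attempts:
  assumes "finite U"
  shows "determined_by {e. 2 \<le> card (e \<inter> U)} (\<lambda>G. attempts bs N G U)"
  using assms
proof (induction N arbitrary: U)
  case 0
  then show ?case by (simp add: determined_by_def)
next
  case (Suc N)
  show ?case
  proof (cases "U = {}")
    case True
    then show ?thesis by (simp add: determined_by_def)
  next
    case False
    then have "Min U \<in> U" using Suc.prems by simp
    then have "{Min U} \<union> (U - {Min U}) = U" by auto
    then show ?thesis
      using determined_by_grow[OF Suc.IH, of "{Min U}" "U - {Min U}" "{}" bs] Suc.prems False by auto
  qed
qed

context hypergraph_model
begin

text \<open>The success probability if exactly \<open>u\<close> unseen vertices were available in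
  every step; \<open>t\<close> counts the processed vertices and \<open>m\<close> is the current
  block size.\<close>

primrec grow_prob :: "nat \<Rightarrow> nat \<Rightarrow> nat \<Rightarrow> nat list \<Rightarrow> real" where
  "grow_prob u t m [] = 1"
| "grow_prob u t m (b # bs) = binomial_tail u (hit t m) b * grow_prob u (t + m) b bs"

lemma grow_prob_bounds: "0 \<le> grow_prob u t m bs \<and> grow_prob u t m bs \<le> 1"
  using binomial_tail_bounds[OF hit_bounds]
  by (induction bs arbitrary: t m) (auto simp: mult_le_one)

text \<open>Failure requires that some block falls short and that the fallback then fails as well.
  The reserve \<open>sum_list bs\<close> keeps at least \<open>u1\<close> vertices in
  \<open>U\<close> at every stage, and fewer trials only lower the tail, so \<open>u0\<close> may
  replace the true count.\<close>

lemma prob_not_grow_le: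
  assumes det: "\<And>U. finite U \<Longrightarrow> determined_by {e. 2 \<le> card (e \<inter> U)} (\<lambda>G. fb G U)"
    and fb: "\<And>U. U \<subseteq> {..<n} \<Longrightarrow> u1 \<le> card U \<Longrightarrow> pr {G. \<not> fb G U} \<le> \<phi>" and "0 \<le> \<phi>" "u0 \<le> u1"
    and "P \<union> A \<union> U \<subseteq> {..<n}" "P \<inter> A = {}" "(P \<union> A) \<inter> U = {}" "u1 + sum_list bs \<le> card U"
  shows "pr {G. \<not> grow fb G bs P A U} \<le> (1 - grow_prob u0 (card P) (card A) bs) * \<phi>"
  using assms(5-)
proof (induction bs arbitrary: P A U)
  case Nil
  then show ?case by simp
next
  case (Cons b bs)
  let ?q = "hit (card P) (card A)"
  let ?g = "grow_prob u0 (card P + card A) b bs"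
  have fin: "finite P" "finite A" "finite U"
    using Cons.prems finite_subset[OF _ finite_lessThan] by blast+
  have g: "0 \<le> ?g" "?g \<le> 1" using grow_prob_bounds by auto
  define F where "F C G \<longleftrightarrow> \<not> (if b \<le> card C then grow fb G bs (P \<union> A) (pick b C) (U - pick b C)
      else fb G U)" for C and G :: "nat set \<Rightarrow> bool"
  have "pr {G. \<not> grow fb G (b # bs) P A U} = pr {G. F (children G P A U) G}"
    by (simp add: F_def)
  also have "\<dots> \<le> (\<Sum>C\<in>Pow U. ?q ^ card C * (1 - ?q) ^ (card U - card C) *
      (\<phi> - ?g * \<phi> * (if b \<le> card C then 1 else 0)))"
  proof (rule prob_children_step_le)
    fix C assume C: "C \<subseteq> U"
    show "determined_by {e. 2 \<le> card (e \<inter> (A - A \<union> U))} (F C)"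
    proof (cases "b \<le> card C")
      case True
      have B: "pick b C \<subseteq> U" using pick(1)[OF True] C by blast
      then have "pick b C \<union> (U - pick b C) = U" by auto
      moreover have "determined_by {e. 2 \<le> card (e \<inter> (pick b C \<union> (U - pick b C)))}
          (\<lambda>G. grow fb G bs (P \<union> A) (pick b C) (U - pick b C))"
        using B Cons.prems fin finite_subset[OF B] by (intro determined_by_grow det) auto
      ultimately show ?thesis
        using True by (auto simp: F_def[abs_def] determined_by_def)
    next
      case False
      then show ?thesis
        using det[OF fin(3)] by (auto simp: F_def[abs_def] determined_by_def)
    qed
    show "pr {G. F C G} \<le> \<phi> - ?g * \<phi> * (if b \<le> card C then 1 else 0)"
    proof (cases "b \<le> card C")
      case True
      have B: "pick b C \<subseteq> U" "card (pick b C) = b" using pick[OF True] C by auto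
      have "card (U - pick b C) = card U - b"
        using B fin finite_subset[OF B(1)] by (simp add: card_Diff_subset)
      then have "pr {G. \<not> grow fb G bs (P \<union> A) (pick b C) (U - pick b C)} \<le>
          (1 - grow_prob u0 (card (P \<union> A)) (card (pick b C)) bs) * \<phi>"
        using B Cons.prems by (intro Cons.IH) auto
      moreover have "card (P \<union> A) = card P + card A"
        using fin Cons.prems by (intro card_Un_disjoint) auto
      ultimately show ?thesis
        using True B by (simp add: F_def algebra_simps)
    next
      case False
      then show ?thesis using fb[of U] Cons.prems by (simp add: F_def)
    qed
  qed (use Cons.prems in auto)
  also have "\<dots> = \<phi> * (\<Sum>C\<in>Pow U. ?q ^ card C * (1 - ?q) ^ (card U - card C) * 1 ^ card C) - ?g * \<phi> *
      (\<Sum>C\<in>Pow U. ?q ^ card C * (1 - ?q) ^ (card U - card C) * (if b \<le> card C then 1 else 0))"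
    unfolding sum_distrib_left sum_subtractf[symmetric]
    by (intro sum.cong) (auto simp: algebra_simps)
  also have "\<dots> = \<phi> - ?g * \<phi> * binomial_tail (card U) ?q b"
    unfolding sum_Pow_binomial_tail[OF fin(3)] sum_Pow_binomial[OF fin(3)] by simp
  also have "\<dots> \<le> \<phi> - ?g * \<phi> * binomial_tail u0 ?q b"
    using Cons.prems \<open>u0 \<le> u1\<close> \<open>0 \<le> \<phi>\<close> g hit_bounds
    by (intro diff_left_mono mult_left_mono binomial_tail_mono_left) auto
  finally show ?case by (simp add: algebra_simps)
qed

text \<open>An attempt consumes its root and at most \<open>sum_list bs\<close> further vertices, so
  all \<open>N\<close> attempts have \<open>u0\<close> unseen vertices at their disposal and their
  failure bounds multiply.\<close>

lemma prob_not_attempts_le: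
  assumes "U \<subseteq> {..<n}" "u0 + N * Suc (sum_list bs) \<le> card U"
  shows "pr {G. \<not> attempts bs N G U} \<le> (1 - grow_prob u0 0 1 bs) ^ N"
  using assms
proof (induction N arbitrary: U)
  case 0
  then show ?case by simp
next
  case (Suc N)
  have fin: "finite U" using Suc.prems finite_subset[OF _ finite_lessThan] by blast
  have "U \<noteq> {}" using Suc.prems by auto
  then have u: "Min U \<in> U" using fin by simp
  have "card (U - {Min U}) = card U - 1" using u fin by simp
  then have "pr {G. \<not> grow (attempts bs N) G bs {} {Min U} (U - {Min U})} \<le>
      (1 - grow_prob u0 (card ({} :: nat set)) (card {Min U}) bs) * (1 - grow_prob u0 0 1 bs) ^ N"
    using Suc.prems u grow_prob_bounds
    by (intro prob_not_grow_le[where ?u1.0 = "u0 + N * Suc (sum_list bs)"] determined_by_attempts Suc.IH)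
       auto
  then show ?case using \<open>U \<noteq> {}\<close> by simp
qed

end

section \<open>Large closed sets do not exist\<close>

text \<open>Propagation one vertex at a time. As \<open>G\<close> is an arbitrary predicate on sets,
  \<open>f \<noteq> {w}\<close> excludes singleton edges.\<close>

inductive built :: "('a set \<Rightarrow> bool) \<Rightarrow> 'a set \<Rightarrow> bool" for G where
  start: "built G {v}"
| step: "built G S \<Longrightarrow> w \<notin> S \<Longrightarrow> w \<in> f \<Longrightarrow> f \<noteq> {w} \<Longrightarrow> f \<subseteq> insert w S \<Longrightarrow> G f \<Longrightarrow> built G (insert w S)"

lemma built_finite: "built G S \<Longrightarrow> finite S \<and> S \<noteq> {}"
  by (induction rule: built.induct) auto

text \<open>The last conjunct strengthens the induction: as the earlier edges cover
  \<open>S\<close>, a new edge misses their union in \<open>w\<close> only. For a singleton the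
  union is empty, hence the condition on \<open>card S\<close>.\<close>

lemma built_imp_propagation_sequence:
  assumes "built G S"
  shows "\<exists>e. (\<forall>i\<in>{1..card S - 1}. G (e i)) \<and>
    (\<forall>l\<in>{1..card S - 2}. card (e (l + 1) \<inter> (\<Union>i\<in>{1..l}. e i)) = card (e (l + 1)) - 1) \<and>
    (2 \<le> card S \<longrightarrow> (\<Union>i\<in>{1..card S - 1}. e i) = S)"
  using assms
proof induction
  case (start v)
  then show ?case by simp
next
  case (step S w f)
  have fin: "finite S" "S \<noteq> {}" using built_finite[OF step.hyps(1)] by auto
  have card: "card (insert w S) = Suc (card S)" "1 \<le> card S"
    using fin step.hyps by (auto simp: Suc_le_eq card_gt_0_iff)
  show ?case
  \<comment> \<open>From a single vertex the edge is a pair and starts the sequence; otherwise it is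
    appended at index \<open>card S\<close>.\<close>
  proof (cases "card S = 1")
    case True
    then obtain v where "S = {v}" by (auto simp: card_1_singleton_iff)
    then have "f = insert w S" using step.hyps by auto
    then show ?thesis
      using step.hyps True card by (intro exI[of _ "\<lambda>_. f"]) auto
  next
    case False
    define c where "c = card S - 2"
    have c: "card S = Suc (Suc c)" using False card by (simp add: c_def)
    obtain e where e0: "\<forall>i\<in>{1..card S - 1}. G (e i)"
      "\<forall>l\<in>{1..card S - 2}. card (e (l + 1) \<inter> (\<Union>i\<in>{1..l}. e i)) = card (e (l + 1)) - 1"
      "2 \<le> card S \<longrightarrow> (\<Union>i\<in>{1..card S - 1}. e i) = S"
      using step.IH by blast
    have e: "G (e i)" if "i \<in> {1..Suc c}" for i
      using e0(1) that c by simp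
    have e_step: "card (e (l + 1) \<inter> (\<Union>i\<in>{1..l}. e i)) = card (e (l + 1)) - 1" if "l \<in> {1..c}" for l
      using e0(2) that c by simp
    have e_Un: "(\<Union>i\<in>{1..Suc c}. e i) = S"
      using e0(3) c by simp
    let ?e = "e(Suc (Suc c) := f)"
    have U: "(\<Union>i\<in>{1..l}. ?e i) = (\<Union>i\<in>{1..l}. e i)" if "l \<le> Suc c" for l
      using that by (intro SUP_cong) auto
    have "f \<inter> S = f - {w}" using step.hyps by auto
    moreover have "card (f - {w}) = card f - 1" using step.hyps by (simp add: card_Diff_singleton_if)
    ultimately have f: "card (f \<inter> S) = card f - 1" by simp
    show ?thesis
    proof (intro exI[of _ ?e] conjI ballI impI)
      fix i assume "i \<in> {1..card (insert w S) - 1}"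
      then show "G (?e i)" using e[of i] step.hyps card c by auto
    next
      fix l assume l: "l \<in> {1..card (insert w S) - 2}"
      then consider "l \<in> {1..c}" | "l = Suc c" using card c by fastforce
      then show "card (?e (l + 1) \<inter> (\<Union>i\<in>{1..l}. ?e i)) = card (?e (l + 1)) - 1"
      proof cases
        case 1
        then show ?thesis using e_step[of l] U[of l] by auto
      next
        case 2
        then show ?thesis using U[of "Suc c"] e_Un f by auto
      qed
    next
      have "{1..Suc (Suc c)} = insert (Suc (Suc c)) {1..Suc c}" by auto
      then have "(\<Union>i\<in>{1..Suc (Suc c)}. ?e i) = (\<Union>i\<in>{1..Suc c}. ?e i) \<union> f"
        by (simp only: UN_insert fun_upd_same Un_commute)
      also have "\<dots> = insert w S" using U[of "Suc c"] e_Un step.hyps by auto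
      finally show "(\<Union>i\<in>{1..card (insert w S) - 1}. ?e i) = insert w S"
        using card c by simp
    qed
  qed
qed

lemma built_imp_propagation_connected:
  "built G V \<Longrightarrow> propagation_connected V {e. G e}"
  using built_imp_propagation_sequence[of G V] unfolding propagation_connected_def by auto

text \<open>Vertices all reachable from \<open>S\<close> can be added one by one, since a larger set
  keeps the same edges usable.\<close>

lemma built_Un:
  assumes "finite B" "built G S"
    and "\<And>w. w \<in> B \<Longrightarrow> \<exists>f. w \<in> f \<and> f \<noteq> {w} \<and> f \<subseteq> insert w S \<and> G f"
  shows "built G (S \<union> B)"
  using assms
proof (induction B rule: finite_induct)
  case (insert w B)
  then have S: "built G (S \<union> B)" by auto
  show ?case
  proof (cases "w \<in> S \<union> B")
    case True
    then show ?thesis using S by (simp add: insert_absorb)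
  next
    case False
    obtain f where "w \<in> f" "f \<noteq> {w}" "f \<subseteq> insert w S" "G f" using insert.prems(2) by auto
    then show ?thesis using built.step[OF S False, of f] by auto
  qed
qed simp

lemma built_children:
  assumes "built G (P \<union> A)" "B \<subseteq> children G P A U" "finite U" "(P \<union> A) \<inter> U = {}"
  shows "built G (P \<union> A \<union> B)"
proof (rule built_Un[OF _ assms(1)])
  show "finite B" using assms children_subset finite_subset by metis
  fix w assume "w \<in> B"
  then obtain f where f: "w \<in> U" "f \<in> links P A w" "G f"
    using assms(2) by (auto simp: children_def)
  then have "w \<notin> P \<union> A" using assms(4) by auto
  then show "\<exists>f. w \<in> f \<and> f \<noteq> {w} \<and> f \<subseteq> insert w (P \<union> A) \<and> G f"
    using f by (intro exI[of _ f]) (auto simp: links_def)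
qed

text \<open>Each completed block consists of children of the set built so far; the second
  alternative records that the fallback took over.\<close>

lemma grow_imp_built:
  assumes "grow fb G bs P A U" "built G (P \<union> A)" "finite U" "(P \<union> A) \<inter> U = {}"
  shows "(\<exists>S. built G S \<and> S \<subseteq> P \<union> A \<union> U \<and> card (P \<union> A) + sum_list bs \<le> card S) \<or> (\<exists>U'\<subseteq>U. fb G U')"
  using assms
proof (induction bs arbitrary: P A U)
  case Nil
  then show ?case by auto
next
  case (Cons b bs)
  let ?C = "children G P A U"
  show ?case
  proof (cases "b \<le> card ?C")
    case True
    let ?B = "pick b ?C"
    have B: "?B \<subseteq> ?C" "?B \<subseteq> U" "card ?B = b"
      using pick[OF True] children_subset[of G P A U] by auto
    have "built G (P \<union> A \<union> ?B)"
      by (rule built_children[OF Cons.prems(2) B(1) Cons.prems(3,4)])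
    then have IH: "(\<exists>S. built G S \<and> S \<subseteq> P \<union> A \<union> ?B \<union> (U - ?B) \<and> card (P \<union> A \<union> ?B) + sum_list bs \<le> card S)
        \<or> (\<exists>U'\<subseteq>U - ?B. fb G U')"
      using Cons.prems True B by (intro Cons.IH) auto
    have "card (P \<union> A \<union> ?B) = card (P \<union> A) + b"
      using built_finite[OF Cons.prems(2)] B Cons.prems finite_subset[OF B(2)]
      by (subst card_Un_disjoint) auto
    moreover have "P \<union> A \<union> ?B \<union> (U - ?B) = P \<union> A \<union> U" using B by auto
    ultimately show ?thesis using IH by (auto simp: add.assoc)
  next
    case False
    then show ?thesis using Cons.prems by auto
  qed
qed

lemma attempts_imp_built:
  assumes "attempts bs N G U" "finite U"
  shows "\<exists>S\<subseteq>U. built G S \<and> sum_list bs \<le> card S"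
  using assms
proof (induction N arbitrary: U)
  case (Suc N)
  then have u: "Min U \<in> U" by simp
  from Suc.prems have "grow (attempts bs N) G bs {} {Min U} (U - {Min U})" by simp
  then have "(\<exists>S. built G S \<and> S \<subseteq> {} \<union> {Min U} \<union> (U - {Min U}) \<and> card ({} \<union> {Min U}) + sum_list bs \<le> card S) \<or>
      (\<exists>U'\<subseteq>U - {Min U}. attempts bs N G U')"
    by (rule grow_imp_built) (use Suc.prems in \<open>auto intro: built.start\<close>)
  then show ?case
  proof (elim disjE exE conjE)
    fix S assume "built G S" "S \<subseteq> {} \<union> {Min U} \<union> (U - {Min U})"
      "card ({} \<union> {Min U}) + sum_list bs \<le> card S"
    then show ?thesis using u by (intro exI[of _ S]) auto
  next
    fix U' assume U': "U' \<subseteq> U - {Min U}" "attempts bs N G U'"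
    then have "finite U'" using Suc.prems(2) by (auto intro: finite_subset)
    from Suc.IH[OF U'(2) this] U'(1) show ?thesis by blast
  qed
qed simp

text \<open>Closure under triples alone has an exact product probability and is already unlikely at
  polylogarithmic sizes.\<close>

definition triple_closed :: "('a set \<Rightarrow> bool) \<Rightarrow> 'a set \<Rightarrow> 'a set \<Rightarrow> bool" where
  "triple_closed G V S \<longleftrightarrow> (\<forall>T w. T \<subseteq> S \<and> card T = 2 \<and> w \<in> V - S \<longrightarrow> \<not> G (insert w T))"

text \<open>A built set that is not closed under triples gains a vertex; the number of missing
  vertices decreases until none is left.\<close>

lemma built_extend:
  assumes "built G S" "S \<subseteq> V" "K \<le> card S" "finite V"
    and no: "\<And>S. S \<subseteq> V \<Longrightarrow> K \<le> card S \<Longrightarrow> card S < card V \<Longrightarrow> \<not> triple_closed G V S"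
  shows "built G V"
  using assms(1-3)
proof (induction "card V - card S" arbitrary: S rule: less_induct)
  case less
  have "card S \<le> card V" using less.prems assms(4) by (intro card_mono) auto
  show ?case
  proof (cases "card S = card V")
    case True
    then show ?thesis using card_subset_eq[OF assms(4) less.prems(2)] less.prems(1) by simp
  next
    case False
    then have lt: "card S < card V" using \<open>card S \<le> card V\<close> by simp
    obtain T w where T: "T \<subseteq> S" "card T = 2" "w \<in> V" "w \<notin> S" "G (insert w T)"
      using no[OF less.prems(2,3) lt] by (auto simp: triple_closed_def)
    have fin: "finite S" using built_finite[OF less.prems(1)] by simp
    have "T \<noteq> {}" using T by auto
    then have "insert w T \<noteq> {w}" using T by auto
    then have "built G (insert w S)"
      using T less.prems by (intro built.step[of G S w "insert w T"]) auto
    moreover have "card (insert w S) = Suc (card S)" using fin T by simp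
    ultimately show ?thesis
      using less.hyps[of "insert w S"] less.prems T lt by auto
  qed
qed

context hypergraph_model
begin

text \<open>A pair in \<open>S\<close> and a vertex outside determine a triple, and both are
  recovered from its parts inside and outside \<open>S\<close>, so the forbidden triples can be
  counted.\<close>

lemma prob_triple_closed:
  assumes "S \<subseteq> {..<n}"
  shows "pr {G. triple_closed G {..<n} S} = (1 - p3) ^ ((card S choose 2) * (n - card S))"
proof -
  let ?D = "{T. T \<subseteq> S \<and> card T = 2} \<times> ({..<n} - S)"
  let ?Z = "(\<lambda>(T, w). insert w T) ` ?D"
  have fin: "finite S" using assms finite_subset by blast
  have inj: "inj_on (\<lambda>(T, w). insert w T) ?D"
  proof (rule inj_onI, clarify)
    fix T w T' w' assume *: "T \<subseteq> S" "T' \<subseteq> S" "w \<notin> S" "w' \<notin> S" "insert w T = insert w' T'"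
    have "insert w T \<inter> S = T" "insert w T - S = {w}" "insert w' T' \<inter> S = T'" "insert w' T' - S = {w'}"
      using *(1-4) by auto
    then show "T = T' \<and> w = w'" using *(5) by (metis singleton_inject)
  qed
  have card3: "card e = 3" "e \<subseteq> {..<n}" if "e \<in> ?Z" for e
  proof -
    obtain T w where Tw: "T \<subseteq> S" "card T = 2" "w < n" "w \<notin> S" "e = insert w T" using \<open>e \<in> ?Z\<close> by auto
    then have "finite T" "w \<notin> T" using fin finite_subset by auto
    then show "card e = 3" "e \<subseteq> {..<n}" using Tw assms by auto
  qed
  have "triple_closed G {..<n} S \<longleftrightarrow> (\<forall>e\<in>?Z. \<not> G e)" for G
  proof
    assume *: "triple_closed G {..<n} S"
    show "\<forall>e\<in>?Z. \<not> G e"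
    proof
      fix e assume "e \<in> ?Z"
      then obtain T w where "T \<subseteq> S" "card T = 2" "w \<in> {..<n} - S" "e = insert w T" by auto
      then show "\<not> G e" using * unfolding triple_closed_def by metis
    qed
  next
    assume *: "\<forall>e\<in>?Z. \<not> G e"
    show "triple_closed G {..<n} S"
      unfolding triple_closed_def
    proof (intro allI impI)
      fix T w assume "T \<subseteq> S \<and> card T = 2 \<and> w \<in> {..<n} - S"
      then have "insert w T \<in> ?Z" by (intro image_eqI[of _ _ "(T, w)"]) auto
      with * show "\<not> G (insert w T)" by (rule bspec)
    qed
  qed
  then have "pr {G. triple_closed G {..<n} S} = pr {G. \<forall>e\<in>?Z. \<not> G e}"
    by simp
  also have "\<dots> = (\<Prod>e\<in>?Z. 1 - (if card e = 2 then p2 else p3))"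
  proof (intro prob_all_absent subsetI)
    fix e assume "e \<in> ?Z"
    from card3[OF this] show "e \<in> edges2 n \<union> edges3 n" by (simp add: edges3_def)
  qed
  also have "\<dots> = (\<Prod>e\<in>?Z. 1 - p3)"
  proof (rule prod.cong[OF refl])
    fix e assume "e \<in> ?Z"
    from card3(1)[OF this] show "1 - (if card e = 2 then p2 else p3) = 1 - p3" by simp
  qed
  also have "\<dots> = (1 - p3) ^ card ?Z"
    by (rule prod_constant)
  also have "card ?Z = card ?D" by (rule card_image[OF inj])
  also have "\<dots> = (card S choose 2) * (n - card S)"
    using assms fin by (simp add: card_cartesian_product n_subsets card_Diff_subset)
  finally show ?thesis .
qed

text \<open>With \<open>m\<close> the smaller of \<open>s\<close> and \<open>n - s\<close>, there
  are at most \<open>n ^ m\<close> sets, while the exponent of the closure probability is at least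
  \<open>3 * m * ln n\<close>. This leaves \<open>n powr (- 2 * m)\<close>.\<close>

lemma binomial_mult_power_le:
  assumes n: "2 \<le> n" and K: "1 \<le> K" "12 * ln (real n) \<le> p3 * real n * (real K - 1)"
    and big: "24 * ln (real n) \<le> p3 * real n * (real n - 2)" and s: "K \<le> s" "s < n"
  shows "real (n choose s) * (1 - p3) ^ ((s choose 2) * (n - s)) \<le> 1 / (real n)\<^sup>2"
proof -
  define L where "L = ln (real n)"
  have L: "0 < L" using n by (simp add: L_def)
  have nL: "real (n ^ j) = exp (real j * L)" for j
    using n by (simp add: L_def exp_of_nat_mult)
  have c2: "real (s choose 2) = real s * (real s - 1) / 2"
    using s K by (simp add: choose_two real_of_nat_div of_nat_diff)
  define m where "m = (if 2 * s \<le> n then s else n - s)"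
  have m: "1 \<le> m" using s K by (auto simp: m_def)
  have choose: "real (n choose s) \<le> exp (real m * L)"
  proof -
    have "n choose s \<le> n ^ s" "n choose (n - s) \<le> n ^ (n - s)"
      using s by (auto intro: binomial_le_pow)
    then have "n choose s \<le> n ^ m"
      using s binomial_symmetric[of s n] by (auto simp: m_def)
    then show ?thesis unfolding nL[symmetric] by (rule of_nat_mono)
  qed
  \<comment> \<open>For small \<open>s\<close>, half of the vertices lie outside and each vertex of
    \<open>S\<close> is in at least \<open>K - 1\<close> pairs. For large \<open>s\<close>, there
    are so many pairs that every outside vertex contributes \<open>3 * L\<close>.\<close>
  have expo: "3 * real m * L \<le> p3 * (real (s choose 2) * real (n - s))"
  proof (cases "2 * s \<le> n")
    case True
    have "3 * real s * L \<le> real s * (p3 * real n * (real K - 1)) / 4"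
      using mult_left_mono[OF K(2), of "real s"] by (simp add: L_def mult_ac)
    also have "\<dots> \<le> real s * (p3 * (2 * real (n - s)) * (real s - 1)) / 4"
      using s K True p3 by (intro divide_right_mono mult_left_mono mult_mono) (auto simp: of_nat_diff)
    also have "\<dots> = p3 * (real (s choose 2) * real (n - s))"
      by (simp add: c2)
    finally show ?thesis using True by (simp add: m_def)
  next
    case False
    have "3 * L \<le> p3 * (real n * (real n - 2)) / 8" using big by (simp add: L_def mult.assoc)
    also have "\<dots> \<le> p3 * ((2 * real s) * (2 * real s - 2)) / 8"
      using False p3 n by (intro divide_right_mono mult_left_mono mult_mono) auto
    also have "\<dots> = p3 * real (s choose 2)"
      by (simp add: c2)
    finally show ?thesis
      using False mult_right_mono[of "3 * L" "p3 * real (s choose 2)" "real (n - s)"]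
      by (simp add: m_def mult_ac)
  qed
  have "(1 - p3) ^ ((s choose 2) * (n - s)) \<le> exp (- p3) ^ ((s choose 2) * (n - s))"
    using p3 exp_ge_add_one_self[of "- p3"] by (intro power_mono) auto
  also have "\<dots> = exp (- (p3 * (real (s choose 2) * real (n - s))))"
    by (simp add: exp_of_nat_mult[symmetric] mult_ac)
  also have "\<dots> \<le> exp (- (3 * real m * L))"
    using expo by simp
  finally have "real (n choose s) * (1 - p3) ^ ((s choose 2) * (n - s)) \<le>
      exp (real m * L) * exp (- (3 * real m * L))"
    using choose p3 by (intro mult_mono) auto
  also have "\<dots> = exp (- (2 * real m * L))"
    by (simp add: exp_add[symmetric])
  also have "\<dots> \<le> exp (- (2 * 1 * L))"
    using m L by simp
  also have "\<dots> = 1 / (real n)\<^sup>2"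
    using nL[of 2] by (simp add: exp_minus field_simps)
  finally show ?thesis .
qed

text \<open>First moment bound: at most \<open>n\<close> sizes, each contributing at most
  \<open>1 / n^2\<close>.\<close>

lemma prob_ex_triple_closed_le:
  assumes n: "2 \<le> n" and K: "1 \<le> K" "12 * ln (real n) \<le> p3 * real n * (real K - 1)"
    and big: "24 * ln (real n) \<le> p3 * real n * (real n - 2)"
  shows "pr {G. \<exists>S. S \<subseteq> {..<n} \<and> K \<le> card S \<and> card S < n \<and> triple_closed G {..<n} S} \<le> 1 / real n"
proof -
  let ?\<S> = "\<lambda>s. {S. S \<subseteq> {..<n} \<and> card S = s}"
  have fin: "finite (?\<S> s)" for s by simp
  have "pr {G. \<exists>S. S \<subseteq> {..<n} \<and> K \<le> card S \<and> card S < n \<and> triple_closed G {..<n} S} \<le>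
      pr (\<Union>s\<in>{K..<n}. \<Union>S\<in>?\<S> s. {G. triple_closed G {..<n} S})"
  proof (rule measure_pmf.finite_measure_mono[OF subsetI])
    fix G assume "G \<in> {G. \<exists>S. S \<subseteq> {..<n} \<and> K \<le> card S \<and> card S < n \<and> triple_closed G {..<n} S}"
    then obtain S where "S \<subseteq> {..<n}" "K \<le> card S" "card S < n" "triple_closed G {..<n} S"
      by (elim CollectE exE conjE)
    then show "G \<in> (\<Union>s\<in>{K..<n}. \<Union>S\<in>?\<S> s. {G. triple_closed G {..<n} S})"
      by (intro UN_I[of "card S"] UN_I[of S]) simp_all
  qed simp
  also have "\<dots> \<le> (\<Sum>s\<in>{K..<n}. pr (\<Union>S\<in>?\<S> s. {G. triple_closed G {..<n} S}))"
    by (intro measure_pmf.finite_measure_subadditive_finite) auto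
  also have "\<dots> \<le> (\<Sum>s\<in>{K..<n}. \<Sum>S\<in>?\<S> s. pr {G. triple_closed G {..<n} S})"
    using fin by (intro sum_mono measure_pmf.finite_measure_subadditive_finite) auto
  also have "\<dots> = (\<Sum>s\<in>{K..<n}. real (n choose s) * (1 - p3) ^ ((s choose 2) * (n - s)))"
    by (intro sum.cong refl) (simp add: prob_triple_closed n_subsets)
  also have "\<dots> \<le> (\<Sum>s\<in>{K..<n}. 1 / (real n)\<^sup>2)"
    using assms by (intro sum_mono binomial_mult_power_le) auto
  also have "\<dots> \<le> real n * (1 / (real n)\<^sup>2)"
    by (simp add: divide_right_mono)
  also have "\<dots> = 1 / real n"
    by (simp add: power2_eq_square)
  finally show ?thesis .
qed

end

section \<open>Estimates for the block growth\<close>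

text \<open>A weak form of Stirling's formula. The induction step rests on
  \<open>(1 + 1 / b) ^ (b + 1) \<ge> exp 1\<close>, which follows from
  \<open>ln z \<ge> 1 - 1 / z\<close>.\<close>

lemma fact_mult_exp_le:
  assumes "1 \<le> b"
  shows "fact b * exp (real b) \<le> exp 1 * real b * real b ^ b"
  using assms
proof (induction b rule: nat_induct_at_least)
  case (Suc b)
  have z: "0 < 1 + 1 / real b" by (intro add_pos_nonneg) auto
  have "1 - inverse (1 + 1 / real b) \<le> ln (1 + 1 / real b)"
    using ln_le_minus_one[of "inverse (1 + 1 / real b)"] z by (simp add: ln_inverse)
  then have "1 \<le> real (Suc b) * ln (1 + 1 / real b)"
    using Suc.hyps by (simp add: field_simps)
  then have "exp 1 \<le> exp (real (Suc b) * ln (1 + 1 / real b))"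
    by simp
  also have "\<dots> = exp (ln (1 + 1 / real b)) ^ Suc b"
    by (rule exp_of_nat_mult)
  also have "exp (ln (1 + 1 / real b)) = 1 + 1 / real b"
    by (rule exp_ln[OF z])
  also have "1 + 1 / real b = real (Suc b) / real b"
    using Suc.hyps by (simp add: field_simps)
  also have "\<dots> ^ Suc b = real (Suc b) ^ Suc b / real b ^ Suc b"
    by (rule power_divide)
  finally have e: "exp 1 * real b ^ Suc b \<le> real (Suc b) ^ Suc b"
    using Suc.hyps by (simp add: field_simps)
  have "fact (Suc b) * exp (real (Suc b)) = real (Suc b) * exp 1 * (fact b * exp (real b))"
    by (simp add: exp_add algebra_simps)
  also have "\<dots> \<le> real (Suc b) * exp 1 * (exp 1 * real b * real b ^ b)"
    using Suc.IH by (intro mult_left_mono) auto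
  also have "\<dots> = real (Suc b) * exp 1 * (exp 1 * real b ^ Suc b)"
    by simp
  also have "\<dots> \<le> real (Suc b) * exp 1 * real (Suc b) ^ Suc b"
    using e by (intro mult_left_mono) auto
  finally show ?case by (simp add: mult_ac)
qed simp

text \<open>From \<open>ln (1 - y) \<ge> - y - 2 * y^2\<close>; the quadratic terms add up to at
  most 1.\<close>

lemma one_minus_power_ge:
  assumes "0 \<le> y" "y \<le> 1 / 2" "2 * real n * y\<^sup>2 \<le> 1"
  shows "exp (- (real n * y) - 1) \<le> (1 - y) ^ n"
proof -
  have "real n * (- y - 2 * y\<^sup>2) \<le> real n * ln (1 - y)"
    using assms by (intro mult_left_mono ln_one_minus_pos_lower_bound) auto
  then have "exp (- (real n * y) - 1) \<le> exp (real n * ln (1 - y))"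
    using assms by (simp add: algebra_simps)
  also have "\<dots> = (1 - y) ^ n"
    using assms by (simp add: exp_of_nat_mult)
  finally show ?thesis .
qed

text \<open>Without its first term the sum is a right Riemann sum of a nondecreasing function, hence
  above the integral. Capping at 1, where \<open>rate\<close> vanishes, makes later terms free;
  stopping early only drops nonpositive terms.\<close>

lemma sum_rate_ge:
  assumes "0 < x" "x \<le> 1" "0 < d"
  shows "d * rate x + Rate 1 - Rate x \<le> d * (\<Sum>j<J. rate (min 1 (x + real j * d)))"
proof -
  define g where "g j = min 1 (x + real j * d)" for j
  have g: "0 < g j" "g j \<le> 1" "g j \<le> g (Suc j)" for j
    using assms by (auto simp: g_def min_def algebra_simps intro: add_pos_nonneg)
  have R1: "Rate 1 \<le> Rate (g j)" for j
    using Rate_diff_bounds(2)[OF g(1,2), of j] by (simp add: rate_def)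
  have "d * rate x + Rate (g J) - Rate x \<le> d * (\<Sum>j<Suc J. rate (g j))" for J
  proof (induction J)
    case 0
    then show ?case using assms by (simp add: g_def)
  next
    case (Suc J)
    have "Rate (g (Suc J)) - Rate (g J) \<le> d * rate (g (Suc J))"
    proof (cases "x + real (Suc J) * d \<le> 1")
      case True
      then have "g (Suc J) - g J = d" using assms by (simp add: g_def min_def algebra_simps)
      then show ?thesis
        using Rate_diff_bounds(2)[OF g(1,3,2), of J] by (simp add: mult.commute)
    next
      case False
      then have "g (Suc J) = 1" by (simp add: g_def)
      then show ?thesis using R1[of J] by (simp add: rate_def)
    qed
    then show ?case using Suc.IH by (simp add: algebra_simps)
  qed
  then have *: "d * rate x + Rate 1 - Rate x \<le> d * (\<Sum>j<Suc J. rate (g j))" for J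
    using R1[of J] by (smt (verit))
  show ?thesis
  proof (cases J)
    case 0
    have "Rate 1 - Rate x \<le> 0" using R1[of 0] assms by (simp add: g_def)
    moreover have "d * rate x \<le> 0" using rate_nonpos[of x] assms by (simp add: mult_nonneg_nonpos)
    ultimately show ?thesis using 0 by simp
  next
    case (Suc J')
    then show ?thesis using *[of J'] by (simp add: g_def)
  qed
qed

text \<open>The starting size \<open>b\<close> is not in the list, as it belongs to the block built
  before.\<close>

primrec doubling :: "nat \<Rightarrow> nat \<Rightarrow> nat list" where
  "doubling 0 b = []"
| "doubling (Suc l) b = 2 * b # doubling l (2 * b)"

lemma sum_list_doubling: "sum_list (doubling l b) + 2 * b = b * 2 ^ Suc l"
proof (induction l arbitrary: b)
  case (Suc l)
  from Suc.IH[of "2 * b"] show ?case by simp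
qed simp

context hypergraph_model
begin

text \<open>All links are absent with probability at most \<open>exp (- y)\<close>, and
  \<open>exp (- y) \<le> 1 / (1 + y)\<close>.\<close>

lemma hit_ge:
  assumes "0 \<le> y" "y \<le> real m * (p2 + real t * p3)"
  shows "y / (1 + y) \<le> hit t m"
proof -
  have "(1 - p2) ^ m * (1 - p3) ^ (m * t) \<le> exp (- p2) ^ m * exp (- p3) ^ (m * t)"
    using p2 p3 exp_ge_add_one_self[of "- p2"] exp_ge_add_one_self[of "- p3"]
    by (intro mult_mono power_mono) auto
  also have "\<dots> = exp (- (real m * (p2 + real t * p3)))"
    by (simp add: exp_of_nat_mult[symmetric] exp_add[symmetric] algebra_simps)
  also have "\<dots> \<le> exp (- y)"
    using assms by simp
  also have "\<dots> \<le> 1 / (1 + y)"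
    using exp_ge_add_one_self[of y] assms by (simp add: exp_minus field_simps)
  finally show ?thesis
    using assms by (simp add: hit_def field_simps)
qed

text \<open>The number of children compares with a Poisson variable of mean \<open>b * g\<close>,
  whose mass at \<open>b\<close> is \<open>exp (b * rate g)\<close> up to the Stirling factor.
  Stirling costs \<open>1 + ln b\<close>, the passage to the exponential another 1.\<close>

lemma binomial_tail_hit_ge:
  assumes b: "1 \<le> b" "2 * b\<^sup>2 \<le> n" and g: "0 < g" "g \<le> 1" "g \<le> real n * (p2 + real t * p3)"
    and c: "0 < c" "c * (1 + real b / real n) \<le> 1" and u: "c * real n + real b \<le> real u" "u \<le> n"
  shows "exp (real b * rate g + 2 * real b * ln c - 2 - ln (real b)) \<le> binomial_tail u (hit t b) b"
proof -
  define y where "y = real b * g / real n"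
  have "b \<le> b\<^sup>2" using b by (simp add: power2_eq_square)
  then have n: "0 < n" "2 * real b \<le> real n" using b by linarith+
  have "real (2 * b\<^sup>2) \<le> real n" using b(2) by (rule of_nat_mono)
  then have n2: "2 * (real b)\<^sup>2 \<le> real n" by simp
  have bg: "real b * g \<le> real b" using g by (simp add: mult_left_le)
  have y: "0 < y" "y \<le> real b / real n" "real n * y = real b * g"
    using b g n bg by (auto simp: y_def divide_right_mono)
  have "real b / real n \<le> 1 / 2" using n by (simp add: field_simps)
  then have y2: "y \<le> 1 / 2" using y(2) by linarith
  have c1: "c \<le> 1"
    using c n by (metis add_increasing2 divide_nonneg_nonneg mult_left_le mult_le_cancel_left1 of_nat_0_le_iff order.refl order.trans less_eq_real_def mult.right_neutral mult_left_mono)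
  have "c * y \<le> y / (1 + y)"
  proof -
    have "c * (1 + y) \<le> c * (1 + real b / real n)" using y c by (intro mult_left_mono) auto
    then have "c * (1 + y) \<le> 1" using c(2) by (rule order.trans)
    then show ?thesis using y mult_right_mono[of "c * (1 + y)" 1 y] by (simp add: field_simps)
  qed
  also have "\<dots> \<le> hit t b"
  proof (rule hit_ge)
    show "y \<le> real b * (p2 + real t * p3)"
      using mult_left_mono[OF g(3), of "real b"] n by (simp add: y_def field_simps)
  qed (use y in auto)
  finally have hit: "c * y \<le> hit t b" .
  have cy: "0 \<le> c * y" "c * y \<le> y" "c * y \<le> 1" using y y2 c c1 by (auto simp: mult_left_le_one_le intro: order.trans[OF mult_left_le_one_le])
  have "real b \<le> real u" using u c n by (smt (verit) mult_nonneg_nonneg of_nat_0_le_iff)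
  then have bu: "b \<le> u" by simp
  \<comment> \<open>One factor \<open>c\<close> comes from the shrunken set of unseen vertices, the
    other from the bound on \<open>hit\<close>.\<close>
  have lo: "c\<^sup>2 * (real b * g) \<le> (real u - real b) * (c * y)"
  proof -
    have "c\<^sup>2 * (real b * g) = (c * real n) * (c * y)"
      using y(3) by (simp add: power2_eq_square mult_ac)
    also have "\<dots> \<le> (real u - real b) * (c * y)"
      using u cy by (intro mult_right_mono) auto
    finally show ?thesis .
  qed
  have ef: "exp (real b - 1) / real b \<le> real b ^ b / fact b"
    using fact_mult_exp_le[OF b(1)] b by (simp add: field_simps exp_diff)
  have "exp (real b * rate g + 2 * real b * ln c - 2 - ln (real b)) =
      (c\<^sup>2 * g) ^ b * (exp (real b - 1) / real b) * exp (- (real b * g) - 1)"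
  proof -
    have "exp (2 * ln c + ln g) = c\<^sup>2 * g"
      by (simp only: exp_add mult_2 exp_ln[OF c(1)] exp_ln[OF g(1)] power2_eq_square)
    then have "(c\<^sup>2 * g) ^ b = exp (real b * (2 * ln c + ln g))"
      by (simp only: exp_of_nat_mult)
    moreover have "exp (real b - 1) / real b = exp (real b - 1) * exp (- ln (real b))"
      using b by (simp add: exp_minus divide_inverse)
    ultimately have "(c\<^sup>2 * g) ^ b * (exp (real b - 1) / real b) * exp (- (real b * g) - 1) =
      exp (real b * (2 * ln c + ln g)) * exp (real b - 1) * exp (- (real b * g) - 1) * exp (- ln (real b))"
      by (simp only: mult_ac)
    also have "\<dots> = exp (real b * rate g + 2 * real b * ln c - 2 - ln (real b))"
      unfolding exp_add[symmetric] by (simp add: rate_def algebra_simps)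
    finally show ?thesis by simp
  qed
  also have "\<dots> \<le> (c\<^sup>2 * g) ^ b * (real b ^ b / fact b) * exp (- (real b * g) - 1)"
    using ef g by (intro mult_right_mono mult_left_mono) auto
  also have "\<dots> = (c\<^sup>2 * (real b * g)) ^ b / fact b * exp (- (real n * y) - 1)"
    by (simp add: y(3) power_mult_distrib)
  also have "\<dots> \<le> ((real u - real b) * (c * y)) ^ b / fact b * (1 - c * y) ^ u"
  proof (intro mult_mono divide_right_mono power_mono[OF lo])
    have "2 * real n * y\<^sup>2 \<le> 2 * real n * (real b / real n)\<^sup>2"
      using y by (intro mult_left_mono power_mono) auto
    also have "\<dots> \<le> 1" using n n2 by (simp add: power2_eq_square field_simps)
    finally have "exp (- (real n * y) - 1) \<le> (1 - y) ^ n"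
      using y y2 by (intro one_minus_power_ge) auto
    also have "\<dots> \<le> (1 - y) ^ u" using u y y2 by (intro power_decreasing) auto
    also have "\<dots> \<le> (1 - c * y) ^ u" using cy y2 by (intro power_mono) auto
    finally show "exp (- (real n * y) - 1) \<le> (1 - c * y) ^ u" .
    have "0 \<le> real u - real b" using bu by simp
    then show "0 \<le> ((real u - real b) * (c * y)) ^ b / fact b" using cy by simp
  qed (use g cy bu c in auto)
  also have "\<dots> \<le> binomial_tail u (c * y) b"
    using cy bu by (intro binomial_tail_ge) auto
  also have "\<dots> \<le> binomial_tail u (hit t b) b"
    using cy hit hit_bounds by (intro binomial_tail_mono_prob) auto
  finally show ?thesis .
qed

text \<open>The step from the single root to a full block of size \<open>b\<close>: no triples are
  available yet, and the cost is a constant for constant \<open>b\<close>.\<close>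

lemma binomial_tail_first_ge:
  assumes "2 \<le> n" "p2 = x / real n" "0 < x" "x \<le> 1" "0 < c"
    and u: "c * real n + real b \<le> real u" "u \<le> n"
  shows "(c * x) ^ b / fact b * exp (-2) \<le> binomial_tail u (hit 0 1) b"
proof -
  have "real b \<le> real u" using u assms by (smt (verit) mult_nonneg_nonneg of_nat_0_le_iff)
  then have bu: "b \<le> u" "0 \<le> real u - real b" by simp_all
  have "x / real n \<le> 1 / 2" using assms by (intro frac_le) auto
  then have half: "p2 \<le> 1 / 2" using assms by simp
  have "c * x = c * real n * p2" using assms by simp
  also have "\<dots> \<le> (real u - real b) * p2" using u p2 by (intro mult_right_mono) auto
  finally have "c * x \<le> (real u - real b) * p2" .
  then have lo: "(c * x) ^ b \<le> ((real u - real b) * p2) ^ b"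
    using assms by (intro power_mono) auto
  have "(c * x) ^ b / fact b * exp (-2) \<le> ((real u - real b) * p2) ^ b / fact b * (1 - p2) ^ u"
  proof (intro mult_mono divide_right_mono lo)
    have "2 * real n * p2\<^sup>2 = 2 * x * x / real n"
      unfolding assms(2) using assms(1) by (simp add: power2_eq_square field_simps)
    also have "\<dots> \<le> 2 * 1 * 1 / 2"
      using assms by (intro frac_le mult_mono) auto
    finally have "exp (- (real n * p2) - 1) \<le> (1 - p2) ^ n"
      using p2 half by (intro one_minus_power_ge) auto
    moreover have "exp (-2) \<le> exp (- (real n * p2) - 1)" using assms by simp
    moreover have "(1 - p2) ^ n \<le> (1 - p2) ^ u" using u p2 by (intro power_decreasing) auto
    ultimately show "exp (-2) \<le> (1 - p2) ^ u" by linarith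
  qed (use assms bu p2 in auto)
  also have "\<dots> \<le> binomial_tail u p2 b"
    using p2 bu by (intro binomial_tail_ge) auto
  finally show ?thesis by (simp add: hit_def)
qed

text \<open>At least \<open>8 * m\<close> children are expected, against \<open>2 * m\<close>
  required; the Chernoff bound gives failure probability at most
  \<open>(4 * exp (-4)) ^ m\<close>.\<close>

lemma binomial_tail_doubling_ge:
  assumes "1 \<le> m" "32 * real m \<le> real n" "16 \<le> real n * (p2 + real t * p3)" "3 / 4 * real n \<le> real u"
  shows "1 / 2 \<le> binomial_tail u (hit t m) (2 * m)"
proof -
  define y where "y = 16 * real m / real n"
  let ?q = "hit t m"
  have n: "0 < real n" using assms by simp
  have y: "0 \<le> y" "y \<le> 1 / 2" using assms n by (auto simp: y_def field_simps)
  have "y / (1 + 1 / 2) \<le> y / (1 + y)" using y by (intro divide_left_mono) auto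
  also have "\<dots> \<le> ?q"
  proof (rule hit_ge)
    show "y \<le> real m * (p2 + real t * p3)"
      using mult_left_mono[OF assms(3), of "real m"] n by (simp add: y_def field_simps)
  qed (use y in auto)
  finally have "3 / 4 * real n * (y / (1 + 1 / 2)) \<le> real u * ?q"
    using assms y by (intro mult_mono) auto
  then have uq: "8 * real m \<le> real u * ?q" using n by (simp add: y_def)
  have "1 - binomial_tail u ?q (2 * m) \<le> 2 ^ (2 * m) * (1 - ?q / 2) ^ u"
    using hit_bounds by (intro one_minus_binomial_tail_le) auto
  also have "(1 - ?q / 2) ^ u \<le> exp (- ?q / 2) ^ u"
    using hit_bounds[of t m] exp_ge_add_one_self[of "- ?q / 2"] by (intro power_mono) auto
  also have "\<dots> = exp (- (real u * ?q / 2))"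
    by (simp add: exp_of_nat_mult[symmetric])
  also have "\<dots> \<le> exp (- (4 * real m))" using uq by simp
  also have "exp (- (4 * real m)) = exp (-4) ^ m"
    by (simp add: exp_of_nat_mult[symmetric] mult.commute)
  also have "2 ^ (2 * m) * exp (-4) ^ m = (4 * exp (-4 :: real)) ^ m"
    by (simp add: power_mult power_mult_distrib)
  also have "\<dots> \<le> (1 / 2) ^ m"
  proof (rule power_mono)
    have "(2 :: real) ^ 4 \<le> exp 1 ^ 4"
      using exp_ge_add_one_self[of 1] by (intro power_mono) auto
    then have "16 \<le> exp (4 :: real)" by (simp add: exp_of_nat_mult[symmetric])
    then show "4 * exp (-4) \<le> (1 / 2 :: real)" by (simp add: exp_minus field_simps)
  qed auto
  also have "\<dots> \<le> (1 / 2) ^ 1" using assms(1) by (intro power_decreasing) auto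
  finally show ?thesis by simp
qed

lemma grow_prob_replicate:
  "grow_prob u t b (replicate J b @ bs) =
    (\<Prod>j<J. binomial_tail u (hit (t + j * b) b) b) * grow_prob u (t + J * b) b bs"
proof (induction J arbitrary: t)
  case (Suc J)
  show ?case
    unfolding prod.lessThan_Suc_shift by (simp add: Suc add_ac)
qed simp

lemma grow_prob_doubling_ge:
  assumes "1 \<le> m" "32 * real (m * 2 ^ l) \<le> real n" "16 \<le> real n * (p2 + real t * p3)" "3 / 4 * real n \<le> real u"
  shows "(1 / 2) ^ l \<le> grow_prob u t m (doubling l m)"
  using assms(1-3)
proof (induction l arbitrary: t m)
  case (Suc l)
  have "(1 / 2) ^ l \<le> grow_prob u (t + m) (2 * m) (doubling l (2 * m))"
  proof (rule Suc.IH)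
    have "real n * (p2 + real t * p3) \<le> real n * (p2 + real (t + m) * p3)"
      using p3 by (intro mult_left_mono add_left_mono mult_right_mono) auto
    then show "16 \<le> real n * (p2 + real (t + m) * p3)" using Suc.prems(3) by linarith
  qed (use Suc.prems in \<open>auto simp: mult_ac\<close>)
  moreover have "1 / 2 \<le> binomial_tail u (hit t m) (2 * m)"
  proof (rule binomial_tail_doubling_ge)
    have "real m \<le> real (m * 2 ^ Suc l)"
      using one_le_power[of "2::nat" "Suc l"] by (intro of_nat_mono) simp
    then show "32 * real m \<le> real n" using Suc.prems(2) by linarith
  qed (use Suc.prems assms(4) in auto)
  ultimately have "1 / 2 * (1 / 2) ^ l \<le>
      binomial_tail u (hit t m) (2 * m) * grow_prob u (t + m) (2 * m) (doubling l (2 * m))"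
    using binomial_tail_bounds[OF hit_bounds] by (intro mult_mono) auto
  then show ?case by simp
qed simp

text \<open>If some attempt succeeds and there is no large proper set closed under triples, the
  built set extends to all vertices.\<close>

lemma prob_propagation_connected_ge:
  assumes "2 \<le> n" "1 \<le> sum_list bs" "12 * ln (real n) \<le> p3 * real n * (real (sum_list bs) - 1)"
    and "24 * ln (real n) \<le> p3 * real n * (real n - 2)" "u + N * Suc (sum_list bs) \<le> n"
  shows "1 - (1 - grow_prob u 0 1 bs) ^ N - 1 / real n \<le> pr {G. propagation_connected {..<n} {e. G e}}"
proof -
  let ?bad = "\<lambda>G. \<exists>S. S \<subseteq> {..<n} \<and> sum_list bs \<le> card S \<and> card S < n \<and> triple_closed G {..<n} S"
  have sub: "UNIV - {G. propagation_connected {..<n} {e. G e}} \<subseteq>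
      {G. \<not> attempts bs N G {..<n}} \<union> {G. ?bad G}"
  proof
    fix G assume G: "G \<in> UNIV - {G. propagation_connected {..<n} {e. G e}}"
    show "G \<in> {G. \<not> attempts bs N G {..<n}} \<union> {G. ?bad G}"
    proof (rule ccontr)
      assume "G \<notin> {G. \<not> attempts bs N G {..<n}} \<union> {G. ?bad G}"
      then have att: "attempts bs N G {..<n}" and good: "\<not> ?bad G" by auto
      obtain S where S: "S \<subseteq> {..<n}" "built G S" "sum_list bs \<le> card S"
        using attempts_imp_built[OF att] by auto
      have "built G {..<n}"
      proof (rule built_extend[OF S(2,1,3)])
        fix S assume "S \<subseteq> {..<n}" "sum_list bs \<le> card S" "card S < card {..<n}"
        then show "\<not> triple_closed G {..<n} S" using good unfolding card_lessThan by metis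
      qed simp
      then show False using built_imp_propagation_connected G by blast
    qed
  qed
  have "1 - pr {G. propagation_connected {..<n} {e. G e}} =
      pr (UNIV - {G. propagation_connected {..<n} {e. G e}})"
    using measure_pmf.prob_compl[of "{G. propagation_connected {..<n} {e. G e}}" "random_hypergraph n p2 p3"]
    by simp
  also have "\<dots> \<le> pr ({G. \<not> attempts bs N G {..<n}} \<union> {G. ?bad G})"
    by (rule measure_pmf.finite_measure_mono[OF sub]) simp
  also have "\<dots> \<le> pr {G. \<not> attempts bs N G {..<n}} + pr {G. ?bad G}"
    by (rule measure_Un_le) simp_all
  also have "\<dots> \<le> (1 - grow_prob u 0 1 bs) ^ N + 1 / real n"
    using assms by (intro add_mono prob_not_attempts_le prob_ex_triple_closed_le) auto
  finally show ?thesis by linarith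
qed

text \<open>Three phases: one block from the root, \<open>J\<close> blocks of constant size that
  carry the mean offspring from \<open>x\<close> past 16, and \<open>l\<close> doublings costing a
  factor 2 each.\<close>

lemma grow_prob_ge:
  assumes p: "\<And>t. real n * (p2 + real t * p3) = x + real t * h" "p2 = x / real n"
    and x: "0 < x" "x \<le> 1" and h: "0 < h"
    and b: "1 \<le> b" "2 * b\<^sup>2 \<le> n" and c: "3 / 4 \<le> c" "c * (1 + real b / real n) \<le> 1"
    and u: "c * real n + real b \<le> real u" "u \<le> n"
    and J: "16 \<le> real (J * b) * h" and l: "32 * real (b * 2 ^ l) \<le> real n"
  shows "(c * x) ^ b / fact b * exp (-2) *
      exp (real b * rate x + (Rate 1 - Rate x) / h - real J * (2 + ln (real b) - 2 * real b * ln c)) * (1 / 2) ^ l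
    \<le> grow_prob u 0 1 (replicate (Suc J) b @ doubling l b)"
proof -
  have n: "2 \<le> n" using b by (metis le_square mult_le_mono2 nat_mult_1_right order.trans power2_eq_square)
  \<comment> \<open>A lower bound for the mean offspring per vertex of block \<open>j\<close>.
    Capped at 1, it charges supercritical blocks only the fixed loss per block.\<close>
  define g where "g j = min 1 (x + real j * (real b * h))" for j
  have g: "0 < g j" "g j \<le> 1" for j using x h by (auto simp: g_def add_pos_nonneg)
  have "(real b * rate x + (Rate 1 - Rate x) / h) * h = real b * h * rate x + Rate 1 - Rate x"
    using h by (simp add: field_simps)
  also have "\<dots> \<le> (real b * (\<Sum>j<J. rate (g j))) * h"
    using sum_rate_ge[OF x, of "real b * h" J] b h by (simp add: g_def algebra_simps)
  finally have S: "real b * rate x + (Rate 1 - Rate x) / h \<le> real b * (\<Sum>j<J. rate (g j))"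
    using h by simp
  have "exp (real b * rate x + (Rate 1 - Rate x) / h - real J * (2 + ln (real b) - 2 * real b * ln c)) \<le>
      exp (\<Sum>j<J. real b * rate (g j) + 2 * real b * ln c - 2 - ln (real b))"
    using S by (simp add: sum_distrib_left sum_subtractf sum.distrib algebra_simps)
  also have "\<dots> = (\<Prod>j<J. exp (real b * rate (g j) + 2 * real b * ln c - 2 - ln (real b)))"
    by (rule exp_sum) simp
  also have "\<dots> \<le> (\<Prod>j<J. binomial_tail u (hit (1 + j * b) b) b)"
  proof (intro prod_mono conjI binomial_tail_hit_ge b c u g)
    fix j
    have "g j \<le> x + real (j * b) * h" by (simp add: g_def)
    also have "\<dots> \<le> x + real (1 + j * b) * h" using h by (intro add_left_mono mult_right_mono) auto
    finally show "g j \<le> real n * (p2 + real (1 + j * b) * p3)" unfolding p(1) .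
  qed (use c in auto)
  finally have mid: "exp (real b * rate x + (Rate 1 - Rate x) / h - real J * (2 + ln (real b) - 2 * real b * ln c))
      \<le> (\<Prod>j<J. binomial_tail u (hit (1 + j * b) b) b)" .
  have first: "(c * x) ^ b / fact b * exp (-2) \<le> binomial_tail u (hit 0 1) b"
    using n p x c u by (intro binomial_tail_first_ge) auto
  have last: "(1 / 2) ^ l \<le> grow_prob u (1 + J * b) b (doubling l b)"
  proof (rule grow_prob_doubling_ge)
    have "real (J * b) * h \<le> real (1 + J * b) * h" using h by (intro mult_right_mono) auto
    then show "16 \<le> real n * (p2 + real (1 + J * b) * p3)" unfolding p(1) using J x by linarith
    have "3 / 4 * real n \<le> c * real n" using c by (intro mult_right_mono) auto
    then show "3 / 4 * real n \<le> real u" using u by linarith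
  qed (use b l in auto)
  have "grow_prob u 0 1 (replicate (Suc J) b @ doubling l b) =
      binomial_tail u (hit 0 1) b * (\<Prod>j<J. binomial_tail u (hit (1 + j * b) b) b) *
      grow_prob u (1 + J * b) b (doubling l b)"
    using grow_prob_replicate[of u 1 b J "doubling l b"] by simp
  then show ?thesis
    using mult_mono[OF mult_mono[OF first mid] last] binomial_tail_bounds[OF hit_bounds] c x
    by (auto simp: prod_nonneg)
qed

end

section \<open>Asymptotics of the connected case\<close>

lemma (in hypergraph_model) prob_propagation_connected_ge_exp:
  assumes "2 \<le> n" "1 \<le> sum_list bs" "12 * ln (real n) \<le> p3 * real n * (real (sum_list bs) - 1)"
    and "24 * ln (real n) \<le> p3 * real n * (real n - 2)" "u + N * Suc (sum_list bs) \<le> n"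
    and "\<rho> \<le> grow_prob u 0 1 bs"
  shows "1 - exp (- (real N * \<rho>)) - 1 / real n \<le> pr {G. propagation_connected {..<n} {e. G e}}"
proof -
  have "(1 - grow_prob u 0 1 bs) ^ N \<le> exp (- \<rho>) ^ N"
    using grow_prob_bounds[of u 0 1 bs] assms(6) exp_ge_add_one_self[of "- \<rho>"]
    by (intro power_mono) auto
  also have "\<dots> = exp (- (real N * \<rho>))"
    by (simp add: exp_of_nat_mult[symmetric])
  finally show ?thesis
    using prob_propagation_connected_ge[OF assms(1-5)] by linarith
qed

lemma prob_propagation_connected_tendsto_1:
  fixes \<epsilon> r :: real
  assumes \<epsilon>: "0 < \<epsilon>" "\<epsilon> < 1" and r: "0 < r" and I: "-1 < I_const \<epsilon> r"
  shows "(\<lambda>n. measure_pmf.prob (random_hypergraph n ((1 - \<epsilon>) / real n) (r / (real n * ln (real n))))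
    {G. propagation_connected {..<n} {e. G e}}) \<longlonglongrightarrow> 1"
proof -
  define x where "x = 1 - \<epsilon>"
  have x: "0 < x" "x \<le> 1" using \<epsilon> by (auto simp: x_def)
  \<comment> \<open>A quarter of the slack: one quarter pays for the Stirling losses, one for the
    factors \<open>c\<close>, and two remain for the divergence.\<close>
  define \<delta> where "\<delta> = (1 + I_const \<epsilon> r) / 4"
  have \<delta>: "0 < \<delta>" using I by (simp add: \<delta>_def)
  \<comment> \<open>At most \<open>17 * ln n / (r * b)\<close> blocks lose \<open>2 + ln b\<close>
    each, so a large constant \<open>b\<close> suffices.\<close>
  have "(\<lambda>b. 17 / r * ((2 + ln (real b)) / real b)) \<longlonglongrightarrow> 0"
    by (rule tendsto_mult_right_zero) real_asymp
  then have "\<forall>\<^sub>F b in sequentially. 17 / r * ((2 + ln (real b)) / real b) < \<delta>"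
    using \<delta> by (rule order_tendstoD)
  then obtain b where b: "1 \<le> b" "17 / r * ((2 + ln (real b)) / real b) < \<delta>"
    using eventually_conj[OF _ eventually_ge_at_top[of 1]]
    by (metis (mono_tags, lifting) eventually_sequentially order.refl)
  \<comment> \<open>The loss \<open>- 2 * b * ln c\<close> per block, with
    \<open>c = 1 - \<eta>\<close>, sums to a bound in which \<open>b\<close> cancels.\<close>
  have "((\<lambda>\<eta>. 17 / r * (- 2 * ln (1 - \<eta>))) \<longlongrightarrow> 17 / r * (- 2 * ln (1 - 0))) (at_right 0)"
    by (intro tendsto_intros) auto
  then have "\<forall>\<^sub>F \<eta> in at_right 0. 17 / r * (- 2 * ln (1 - \<eta>)) < \<delta>"
    using \<delta> by (intro order_tendstoD) auto
  then obtain \<eta> where \<eta>: "0 < \<eta>" "\<eta> < 1 / 4" "17 / r * (- 2 * ln (1 - \<eta>)) < \<delta>"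
    using eventually_happens[OF eventually_conj[OF _ eventually_at_right_real[of 0 "1/4"]]] by force
  define c where "c = 1 - \<eta>"
  have c: "3 / 4 \<le> c" "c < 1" using \<eta> by (auto simp: c_def)
  define \<kappa> where "\<kappa> = (c * x) ^ b / fact b * exp (-2) * exp (real b * rate x)"
  have \<kappa>: "0 < \<kappa>" using c x by (simp add: \<kappa>_def)
  \<comment> \<open>The power 8 collects \<open>(ln n) ^ 5\<close> from the number of attempts and
    \<open>(ln n) ^ 3\<close> from the doublings; rounding costs a factor 2 in each.\<close>
  define B where "B n = 1 - exp (- (\<kappa> / 4 * (exp (2 * \<delta> * ln (real n)) / ln (real n) ^ 8))) - 1 / real n" for n
  have B: "B \<longlonglongrightarrow> 1"
    unfolding B_def using \<kappa> \<delta> by real_asymp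
  define L where "L n = ln (real n)" for n
  have c': "1 - c > 0" using c by simp
  have ev: "\<forall>\<^sub>F n in sequentially. 2 * b\<^sup>2 \<le> n" "\<forall>\<^sub>F n in sequentially. c * (1 + real b / real n) \<le> 1"
    "\<forall>\<^sub>F n in sequentially. r * real b \<le> L n"
    "\<forall>\<^sub>F n in sequentially. 32 * real b * (2 * L n ^ 3) \<le> real n"
    "\<forall>\<^sub>F n in sequentially. 1 + (17 * L n / r + real b + 4 * real b * L n ^ 3) \<le> L n ^ 4"
    "\<forall>\<^sub>F n in sequentially. c * real n + 1 + real b + real n / L n \<le> real n"
    "\<forall>\<^sub>F n in sequentially. 2 * L n ^ 5 \<le> real n"
    "\<forall>\<^sub>F n in sequentially. 12 * L n * L n / r + 1 \<le> L n ^ 3"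
    "\<forall>\<^sub>F n in sequentially. 24 * L n * L n \<le> r * (real n - 2)"
    "\<forall>\<^sub>F n in sequentially. 1 \<le> L n"
    unfolding L_def using b(1) r c c' \<eta>(1)
    by (rule eventually_ge_at_top | real_asymp)+
  have main: "\<forall>\<^sub>F n in sequentially. B n \<le> measure_pmf.prob
      (random_hypergraph n ((1 - \<epsilon>) / real n) (r / (real n * ln (real n))))
      {G. propagation_connected {..<n} {e. G e}}"
    using ev eventually_hypergraph_model[OF \<epsilon> r] eventually_ge_at_top[of 2]
  proof eventually_elim
    case (elim n)
    interpret hypergraph_model n "(1 - \<epsilon>) / real n" "r / (real n * ln (real n))" by fact
    note [simp del] = of_nat_mult of_nat_Suc
    have L: "0 < L n" using elim(10) by simp
    have n: "0 < real n" using elim by simp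
    define h where "h = r / L n"
    have h: "0 < h" using r L by (simp add: h_def)
    \<comment> \<open>Enough blocks to raise the mean by 16; rounding up turns 16 into at most
      17.\<close>
    define J where "J = nat \<lceil>16 * L n / (r * real b)\<rceil>"
    have J: "16 * L n / (r * real b) \<le> real J" "real J \<le> 17 * L n / (r * real b)"
    proof -
      show "16 * L n / (r * real b) \<le> real J" unfolding J_def by linarith
      have "0 \<le> 16 * L n / (r * real b)" using L r by simp
      then have "real J \<le> 16 * L n / (r * real b) + 1" unfolding J_def by linarith
      also have "\<dots> \<le> 17 * L n / (r * real b)"
        using elim(3) r b by (simp add: field_simps)
      finally show "real J \<le> 17 * L n / (r * real b)" .
    qed
    \<comment> \<open>The doublings reach total size \<open>(ln n) ^ 3\<close>, above the order
      \<open>(ln n)^2\<close> from which closed sets are excluded.\<close>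
    define l where "l = nat \<lceil>3 * log 2 (L n)\<rceil>"
    have l: "L n ^ 3 \<le> 2 ^ l" "2 ^ l \<le> 2 * L n ^ 3"
    proof -
      have "0 \<le> log 2 (L n)" using elim(10) by simp
      then have *: "3 * log 2 (L n) \<le> real l" "real l \<le> 3 * log 2 (L n) + 1"
        unfolding l_def by linarith+
      have L3: "L n ^ 3 = 2 powr (3 * log 2 (L n))"
        using L by (simp add: powr_powr[symmetric] mult.commute[of 3] powr_numeral)
      have l2: "(2 :: real) ^ l = 2 powr real l" by (simp add: powr_realpow)
      show "L n ^ 3 \<le> 2 ^ l" unfolding L3 l2 using * by simp
      have "2 powr real l \<le> (2 :: real) powr (3 * log 2 (L n) + 1)" using * by simp
      also have "\<dots> = 2 * L n ^ 3" unfolding L3 by (simp add: powr_add)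
      finally show "2 ^ l \<le> 2 * L n ^ 3" unfolding l2 .
    qed
    define bs where "bs = replicate (Suc J) b @ doubling l b"
    have sum_bs: "real (sum_list bs) = real J * real b + 2 * real b * 2 ^ l - real b"
    proof -
      have "sum_list bs + b = J * b + 2 * b * 2 ^ l"
        using sum_list_doubling[of l b] by (simp add: bs_def sum_list_replicate)
      then have "real (sum_list bs + b) = real (J * b + 2 * b * 2 ^ l)"
        by (rule arg_cong)
      then show ?thesis by (simp add: of_nat_mult)
    qed
    \<comment> \<open>The extra \<open>b\<close> compensates for the factor \<open>u - b\<close> in
      the bound on the binomial tail.\<close>
    define u where "u = nat \<lceil>c * real n\<rceil> + b"
    \<comment> \<open>An attempt uses at most \<open>(ln n) ^ 4\<close> vertices, so all of them
      together use at most \<open>n / ln n\<close>, which fits beside the \<open>u\<close> reserved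
      ones.\<close>
    define N where "N = nat \<lfloor>real n / L n ^ 5\<rfloor>"
    define \<rho> where "\<rho> = (c * x) ^ b / fact b * exp (-2) * exp (real b * rate x + (Rate 1 - Rate x) / h -
        real J * (2 + ln (real b) - 2 * real b * ln c)) * (1 / 2) ^ l"
    have u: "c * real n + real b \<le> real u" "real u \<le> c * real n + 1 + real b"
      using c n unfolding u_def by (auto; linarith)+
    have un: "u \<le> n"
    proof -
      have "0 \<le> real n / L n" using n L by simp
      then have "real u \<le> real n" using u elim(6) by linarith
      then show ?thesis by simp
    qed
    have rho: "\<rho> \<le> grow_prob u 0 1 bs"
      unfolding \<rho>_def bs_def
    proof (rule grow_prob_ge)
      show "real n * ((1 - \<epsilon>) / real n + real t * (r / (real n * ln (real n)))) = x + real t * h" for t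
        using n L by (simp add: x_def h_def L_def field_simps)
      have "16 = 16 * L n / (r * real b) * (real b * h)"
        using r b L by (simp add: h_def)
      also have "\<dots> \<le> real J * (real b * h)" using J h by (intro mult_right_mono) auto
      finally show "16 \<le> real (J * b) * h" by (simp add: of_nat_mult mult.assoc)
      have "32 * real b * 2 ^ l \<le> 32 * real b * (2 * L n ^ 3)" using l by (intro mult_left_mono) auto
      then show "32 * real (b * 2 ^ l) \<le> real n" using elim(4) by (simp add: of_nat_mult mult.assoc)
    qed (use elim x h b c u un in \<open>auto simp: x_def\<close>)
    have lower: "L n ^ 3 \<le> real (sum_list bs)"
    proof -
      have "2 ^ l * 1 \<le> 2 ^ l * real b" using b by (intro mult_left_mono) auto
      moreover have "1 * real b \<le> 2 ^ l * real b" by (intro mult_right_mono) auto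
      moreover have "0 \<le> real J * real b" by simp
      moreover have "real (sum_list bs) = real J * real b + 2 ^ l * real b + (2 ^ l * real b - 1 * real b)"
        by (simp add: sum_bs)
      ultimately have "2 ^ l \<le> real (sum_list bs)" by linarith
      then show ?thesis using l by linarith
    qed
    have "1 - exp (- (real N * \<rho>)) - 1 / real n \<le> pr {G. propagation_connected {..<n} {e. G e}}"
    proof (rule prob_propagation_connected_ge_exp[OF _ _ _ _ _ rho])
      have "1 \<le> L n ^ 3" using elim(10) by simp
      then show "1 \<le> sum_list bs" using lower by linarith
      have "12 * L n * L n / r \<le> real (sum_list bs) - 1" using lower elim(8) by linarith
      then show "12 * ln (real n) \<le> r / (real n * ln (real n)) * real n * (real (sum_list bs) - 1)"
        using r n L by (simp add: L_def[symmetric] field_simps)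
      show "24 * ln (real n) \<le> r / (real n * ln (real n)) * real n * (real n - 2)"
        using elim(9) r n L by (simp add: L_def[symmetric] field_simps)
      have "real (Suc (sum_list bs)) \<le> 1 + (17 * L n / r + real b + 4 * real b * L n ^ 3)"
      proof -
        have "real J * real b \<le> 17 * L n / (r * real b) * real b"
          using J by (intro mult_right_mono) auto
        also have "\<dots> = 17 * L n / r" using b by simp
        finally have "real J * real b \<le> 17 * L n / r" .
        moreover have "2 * real b * 2 ^ l \<le> 2 * real b * (2 * L n ^ 3)"
          using l by (intro mult_left_mono) auto
        moreover have "0 \<le> real b" by simp
        ultimately show ?thesis unfolding of_nat_Suc sum_bs by linarith
      qed
      then have S: "real (Suc (sum_list bs)) \<le> L n ^ 4" using elim(5) by linarith
      have "real N \<le> real n / L n ^ 5" using n L unfolding N_def by simp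
      then have "real N * real (Suc (sum_list bs)) \<le> real n / L n ^ 5 * L n ^ 4"
        using S n L by (intro mult_mono) auto
      also have "\<dots> = real n / L n" using L by (simp add: eval_nat_numeral field_simps)
      finally have "real u + real N * real (Suc (sum_list bs)) \<le> real n" using u elim(6) by linarith
      then have "real (u + N * Suc (sum_list bs)) \<le> real n"
        by (simp only: of_nat_add of_nat_mult)
      then show "u + N * Suc (sum_list bs) \<le> n" by (simp only: of_nat_le_iff)
    qed (use elim in auto)
    moreover have "\<kappa> / 4 * (exp (2 * \<delta> * L n) / L n ^ 8) \<le> real N * \<rho>"
    proof -
      have b0: "0 < real b" using b by simp
      have lnb: "0 \<le> 2 + ln (real b) - 2 * real b * ln c"
      proof -
        have "ln c \<le> 0" "0 \<le> ln (real b)" using c b by auto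
        then have "real b * ln c \<le> 0" by (simp add: mult_nonneg_nonpos)
        then show ?thesis using \<open>0 \<le> ln (real b)\<close> by linarith
      qed
      have "real J * (2 + ln (real b) - 2 * real b * ln c) \<le>
          17 * L n / (r * real b) * (2 + ln (real b) - 2 * real b * ln c)"
        using J lnb by (intro mult_right_mono) auto
      also have "\<dots> = (17 / r * ((2 + ln (real b)) / real b) + 17 / r * (- 2 * ln c)) * L n"
        using b0 r by (simp add: field_simps)
      also have "\<dots> \<le> (\<delta> + \<delta>) * L n"
        using b \<eta> L by (intro mult_right_mono add_mono) (auto simp: c_def)
      finally have cost: "real J * (2 + ln (real b) - 2 * real b * ln c) \<le> 2 * \<delta> * L n" by simp
      have IL: "(Rate 1 - Rate x) / h = (4 * \<delta> - 1) * L n"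
        using r L by (simp add: h_def x_def \<delta>_def I_const_eq_Rate field_simps)
      have e1: "exp (real b * rate x) * exp ((2 * \<delta> - 1) * L n) \<le>
          exp (real b * rate x + (Rate 1 - Rate x) / h - real J * (2 + ln (real b) - 2 * real b * ln c))"
        unfolding exp_add[symmetric] exp_le_cancel_iff IL using cost by (simp add: algebra_simps)
      have e2: "1 / (2 * L n ^ 3) \<le> (1 / 2) ^ l"
        using l L by (simp add: power_one_over frac_le)
      have "\<kappa> * exp ((2 * \<delta> - 1) * L n) * (1 / (2 * L n ^ 3)) =
          (c * x) ^ b / fact b * exp (-2) * (exp (real b * rate x) * exp ((2 * \<delta> - 1) * L n)) * (1 / (2 * L n ^ 3))"
        by (simp add: \<kappa>_def)
      also have "\<dots> \<le> \<rho>"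
        unfolding \<rho>_def using e1 e2 c x L by (intro mult_mono) auto
      finally have rho_ge: "\<kappa> * exp ((2 * \<delta> - 1) * L n) * (1 / (2 * L n ^ 3)) \<le> \<rho>" .
      have "1 \<le> real n / (2 * L n ^ 5)" using elim(7) L by (simp add: field_simps)
      moreover have "real n / L n ^ 5 = real n / (2 * L n ^ 5) + real n / (2 * L n ^ 5)" by simp
      moreover have "real n / L n ^ 5 - 1 \<le> real N" unfolding N_def by linarith
      ultimately have N: "real n / (2 * L n ^ 5) \<le> real N" by linarith
      have "exp (2 * \<delta> * L n) = exp ((2 * \<delta> - 1) * L n) * real n"
        using n by (simp add: L_def algebra_simps exp_diff)
      then have "\<kappa> / 4 * (exp (2 * \<delta> * L n) / L n ^ 8) =
          real n / (2 * L n ^ 5) * (\<kappa> * exp ((2 * \<delta> - 1) * L n) * (1 / (2 * L n ^ 3)))"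
        using L by (simp add: eval_nat_numeral field_simps)
      also have "\<dots> \<le> real N * \<rho>"
        using N rho_ge \<kappa> L by (intro mult_mono) auto
      finally show ?thesis .
    qed
    ultimately show ?case
      unfolding B_def L_def[symmetric] by (smt (verit) exp_le_cancel_iff)
  qed
  show ?thesis
    by (rule tendsto_sandwich[OF main _ B tendsto_const]) simp
qed

theorem theorem2:
  fixes \<epsilon> r :: real
  assumes "0 < \<epsilon>" and "\<epsilon> < 1" and "0 < r"
  defines "p2 \<equiv> \<lambda>n::nat. (1 - \<epsilon>) / real n"
      and "p3 \<equiv> \<lambda>n::nat. r / (real n * ln (real n))"
  shows "(I_const \<epsilon> r < -1 \<longrightarrow>
            (\<lambda>n. measure_pmf.prob (random_hypergraph n (p2 n) (p3 n))
                    {G. \<not> propagation_connected {..<n} {e. G e}}) \<longlonglongrightarrow> 1)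
       \<and> (I_const \<epsilon> r > -1 \<longrightarrow>
            (\<lambda>n. measure_pmf.prob (random_hypergraph n (p2 n) (p3 n))
                    {G. propagation_connected {..<n} {e. G e}}) \<longlonglongrightarrow> 1)"
proof (intro conjI impI)
  assume "I_const \<epsilon> r < -1"
  from tendsto_diff[OF tendsto_const prob_propagation_connected_tendsto_0[OF assms(1-3) this], of 1]
  show "(\<lambda>n. measure_pmf.prob (random_hypergraph n (p2 n) (p3 n))
      {G. \<not> propagation_connected {..<n} {e. G e}}) \<longlonglongrightarrow> 1"
    unfolding p2_def p3_def
    using measure_pmf.prob_compl[of "{G. propagation_connected {..<n} {e. G e}}" "random_hypergraph n p q" for n p q]
    by (simp add: set_diff_eq)
next
  assume "-1 < I_const \<epsilon> r"
  then show "(\<lambda>n. measure_pmf.prob (random_hypergraph n (p2 n) (p3 n))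
      {G. propagation_connected {..<n} {e. G e}}) \<longlonglongrightarrow> 1"
    unfolding p2_def p3_def by (rule prob_propagation_connected_tendsto_1[OF assms(1-3)])
qed

end
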